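(* Let $(G_n)_{n\in\mathbb{N}}$ be a sequence of $P\mathcal{M}$-factorizable topological groups and let $G=\prod_{n\in\mathbb{N}}G_n$ be their topological product group. Then $G$ is $P\mathcal{M}$-factorizable if and only if either every $G_n$ is metrizable, or every $G_n$ is $P\mathbb{R}$-factorizable.
   Context: All topological spaces (in particular all topological groups) are assumed Hausdorff. A continuous map $f:X\to Y$ is perfect if it is closed, onto, and all fibers $f^{-1}(y)$ are compact; a perfect homomorphism is a continuous group homomorphism that is a perfect map. A topological group $G$ is $P\mathbb{R}$-factorizable (respectively, $P\mathcal{M}$-factorizable) if for every continuous function $f:G\to\mathbb{R}$ there are a perfect homomorphism $\pi:G\to H$ onto a second-countable (respectively, metrizable) topological group $H$ and a continuous function $g:H\to\mathbb{R}$ such that $f=g\circ\pi$. *)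

theory Defs
  imports "HOL-Analysis.Analysis" "HOL-Algebra.Product_Groups"
begin

text \<open>All topological groups are Hausdorff.\<close>

definition topological_group :: "'a monoid \<Rightarrow> 'a topology \<Rightarrow> bool" where
  "topological_group G T \<longleftrightarrow>
     group G \<and> topspace T = carrier G \<and> Hausdorff_space T \<and>
     continuous_map (prod_topology T T) T (\<lambda>(x, y). x \<otimes>\<^bsub>G\<^esub> y) \<and>
     continuous_map T T (\<lambda>x. inv\<^bsub>G\<^esub> x)"

definition perfect_hom :: "'a monoid \<Rightarrow> 'a topology \<Rightarrow> 'b monoid \<Rightarrow> 'b topology \<Rightarrow> ('a \<Rightarrow> 'b) \<Rightarrow> bool" where
  "perfect_hom G T H S p \<longleftrightarrow> p \<in> hom G H \<and> perfect_map T S p"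

text \<open>
  HOL cannot quantify over the type carrying the group \<open>H\<close> below. Taking it to be the type
  of \<open>G\<close> loses no generality, because \<open>H\<close> is a surjective image of \<open>G\<close>; see
  \<open>PR_factorizableI\<close> and \<open>PM_factorizableI\<close>, where \<open>H\<close> may live on any type.
\<close>

definition PR_factorizable :: "'a monoid \<Rightarrow> 'a topology \<Rightarrow> bool" where
  "PR_factorizable G T \<longleftrightarrow>
     (\<forall>f :: 'a \<Rightarrow> real. continuous_map T euclideanreal f \<longrightarrow>
        (\<exists>(H :: 'a monoid) S p g.
           topological_group H S \<and> second_countable S \<and> perfect_hom G T H S p \<and>
           continuous_map S euclideanreal g \<and> (\<forall>x\<in>carrier G. f x = g (p x))))"

definition PM_factorizable :: "'a monoid \<Rightarrow> 'a topology \<Rightarrow> bool" where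
  "PM_factorizable G T \<longleftrightarrow>
     (\<forall>f :: 'a \<Rightarrow> real. continuous_map T euclideanreal f \<longrightarrow>
        (\<exists>(H :: 'a monoid) S p g.
           topological_group H S \<and> metrizable_space S \<and> perfect_hom G T H S p \<and>
           continuous_map S euclideanreal g \<and> (\<forall>x\<in>carrier G. f x = g (p x))))"

lemma perfect_hom_transfer:
  fixes G :: "'a monoid" and H :: "'b monoid"
  assumes G: "topological_group G T" and H: "topological_group H S"
    and p: "perfect_hom G T H S p"
  obtains H' :: "'a monoid" and S' q r where
    "topological_group H' S'" "perfect_hom G T H' S' q" "homeomorphic_map S' S r"
    "\<And>x. x \<in> carrier G \<Longrightarrow> r (q x) = p x"
proof -
  interpret G: group G using G by (simp add: topological_group_def)
  interpret H: group H using H by (simp add: topological_group_def)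
  have tG: "topspace T = carrier G" and tH: "topspace S = carrier H"
    using G H by (auto simp: topological_group_def)
  have phom: "p \<in> hom G H" and pperf: "perfect_map T S p"
    using p by (auto simp: perfect_hom_def)
  have surj: "p ` carrier G = carrier H"
    using pperf tG tH by (simp add: perfect_map_def)
  define s where "s = inv_into (carrier G) p"
  define A where "A = s ` carrier H"
  define S' where "S' = pullback_topology A p S"
  define H' :: "'a monoid" where
    "H' = \<lparr>carrier = A, monoid.mult = (\<lambda>x y. s (p x \<otimes>\<^bsub>H\<^esub> p y)), one = s \<one>\<^bsub>H\<^esub>\<rparr>"
  have ps: "p (s y) = y" if "y \<in> carrier H" for y
    using that surj by (simp add: s_def f_inv_into_f)
  have sA: "s y \<in> A" if "y \<in> carrier H" for y using that by (simp add: A_def)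
  have pA: "p x \<in> carrier H" and sp: "s (p x) = x" if "x \<in> A" for x
    using that ps by (auto simp: A_def)
  have tS': "topspace S' = A"
    using pA tH by (auto simp: S'_def topspace_pullback_topology)
  have cp: "continuous_map S' S p"
    unfolding S'_def using continuous_map_pullback[OF continuous_map_id[of S], of A p]
    by simp
  have cs: "continuous_map S S' s"
    unfolding S'_def
  proof (rule continuous_map_pullback')
    show "continuous_map S S (p \<circ> s)"
      by (rule continuous_map_eq[OF continuous_map_id]) (auto simp: tH ps)
    show "topspace S \<subseteq> s -` A" using sA tH by auto
  qed
  have hm: "homeomorphic_maps S' S p s"
    using cp cs by (auto simp: homeomorphic_maps_def tS' tH ps sp)
  have grp: "group H'"
  proof (rule groupI)
    fix x assume "x \<in> carrier H'"
    then have x: "x \<in> A" by (simp add: H'_def)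
    show "\<exists>y\<in>carrier H'. y \<otimes>\<^bsub>H'\<^esub> x = \<one>\<^bsub>H'\<^esub>"
      by (rule bexI[of _ "s (inv\<^bsub>H\<^esub> p x)"]) (use x in \<open>auto simp: H'_def ps pA sA\<close>)
  qed (auto simp: H'_def ps pA sA sp H.m_assoc)
  have invH': "inv\<^bsub>H'\<^esub> x = s (inv\<^bsub>H\<^esub> p x)" if "x \<in> A" for x
    by (rule group.inv_equality[OF grp]) (use that in \<open>auto simp: H'_def ps pA sA\<close>)
  have "continuous_map (prod_topology S' S') S' (s \<circ> (\<lambda>(x, y). x \<otimes>\<^bsub>H\<^esub> y) \<circ> (\<lambda>(x, y). (p x, p y)))"
  proof (intro continuous_map_compose)
    show "continuous_map (prod_topology S' S') (prod_topology S S) (\<lambda>(x, y). (p x, p y))"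
      using cp by (simp add: continuous_map_prod_top)
    show "continuous_map (prod_topology S S) S (\<lambda>(x, y). x \<otimes>\<^bsub>H\<^esub> y)"
      using H by (simp add: topological_group_def)
  qed (rule cs)
  then have cm: "continuous_map (prod_topology S' S') S' (\<lambda>(x, y). x \<otimes>\<^bsub>H'\<^esub> y)"
    by (rule continuous_map_eq) (auto simp: H'_def)
  have "continuous_map S' S' (s \<circ> (\<lambda>x. inv\<^bsub>H\<^esub> x) \<circ> p)"
    using cp cs H by (auto simp: topological_group_def intro!: continuous_map_compose)
  then have ci: "continuous_map S' S' (\<lambda>x. inv\<^bsub>H'\<^esub> x)"
    by (rule continuous_map_eq) (auto simp: tS' invH')
  have "Hausdorff_space S'"
    using hm H homeomorphic_Hausdorff_space homeomorphic_space_def topological_group_def by blast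
  then have 1: "topological_group H' S'"
    using grp cm ci tS' by (simp add: topological_group_def H'_def)
  have "perfect_map S S' s"
    using hm homeomorphic_maps_sym homeomorphic_imp_perfect_map homeomorphic_map_maps by blast
  then have "perfect_map T S' (s \<circ> p)"
    using pperf perfect_map_compose by blast
  moreover have "s \<circ> p \<in> hom G H'"
    using phom by (auto simp: hom_def H'_def Pi_iff sA ps)
  ultimately have 2: "perfect_hom G T H' S' (s \<circ> p)"
    by (simp add: perfect_hom_def)
  show ?thesis
  proof (rule that[OF 1 2])
    show "homeomorphic_map S' S p" using hm homeomorphic_map_maps by blast
    show "p ((s \<circ> p) x) = p x" if "x \<in> carrier G" for x
      using that surj ps by auto
  qed
qed

lemma PR_factorizableI:
  fixes G :: "'a monoid"
  assumes G: "topological_group G T"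
    and ex: "\<And>f :: 'a \<Rightarrow> real. continuous_map T euclideanreal f \<Longrightarrow>
        \<exists>(H :: 'b monoid) S p g.
           topological_group H S \<and> second_countable S \<and> perfect_hom G T H S p \<and>
           continuous_map S euclideanreal g \<and> (\<forall>x\<in>carrier G. f x = g (p x))"
  shows "PR_factorizable G T"
  unfolding PR_factorizable_def
proof (intro allI impI)
  fix f :: "'a \<Rightarrow> real" assume "continuous_map T euclideanreal f"
  from ex[OF this] obtain H :: "'b monoid" and S p g
    where H: "topological_group H S" "second_countable S" and p: "perfect_hom G T H S p"
      and g: "continuous_map S euclideanreal g" "\<forall>x\<in>carrier G. f x = g (p x)" by blast
  obtain H' :: "'a monoid" and S' q r where *: "topological_group H' S'" "perfect_hom G T H' S' q"
    and r: "homeomorphic_map S' S r" "\<And>x. x \<in> carrier G \<Longrightarrow> r (q x) = p x"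
    using perfect_hom_transfer[OF G H(1) p] by blast
  have "second_countable S'"
    using H(2) r(1) homeomorphic_map_imp_homeomorphic_space homeomorphic_space_second_countability by blast
  moreover have "continuous_map S' euclideanreal (g \<circ> r)"
    using g(1) r(1) continuous_map_compose homeomorphic_imp_continuous_map by blast
  moreover have "\<forall>x\<in>carrier G. f x = (g \<circ> r) (q x)" using g(2) r(2) by simp
  ultimately show "\<exists>(H :: 'a monoid) S p g.
           topological_group H S \<and> second_countable S \<and> perfect_hom G T H S p \<and>
           continuous_map S euclideanreal g \<and> (\<forall>x\<in>carrier G. f x = g (p x))"
    using * by blast
qed

lemma PM_factorizableI:
  fixes G :: "'a monoid"
  assumes G: "topological_group G T"
    and ex: "\<And>f :: 'a \<Rightarrow> real. continuous_map T euclideanreal f \<Longrightarrow>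
        \<exists>(H :: 'b monoid) S p g.
           topological_group H S \<and> metrizable_space S \<and> perfect_hom G T H S p \<and>
           continuous_map S euclideanreal g \<and> (\<forall>x\<in>carrier G. f x = g (p x))"
  shows "PM_factorizable G T"
  unfolding PM_factorizable_def
proof (intro allI impI)
  fix f :: "'a \<Rightarrow> real" assume "continuous_map T euclideanreal f"
  from ex[OF this] obtain H :: "'b monoid" and S p g
    where H: "topological_group H S" "metrizable_space S" and p: "perfect_hom G T H S p"
      and g: "continuous_map S euclideanreal g" "\<forall>x\<in>carrier G. f x = g (p x)" by blast
  obtain H' :: "'a monoid" and S' q r where *: "topological_group H' S'" "perfect_hom G T H' S' q"
    and r: "homeomorphic_map S' S r" "\<And>x. x \<in> carrier G \<Longrightarrow> r (q x) = p x"
    using perfect_hom_transfer[OF G H(1) p] by blast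
  have "metrizable_space S'"
    using H(2) r(1) homeomorphic_map_imp_homeomorphic_space homeomorphic_metrizable_space by blast
  moreover have "continuous_map S' euclideanreal (g \<circ> r)"
    using g(1) r(1) continuous_map_compose homeomorphic_imp_continuous_map by blast
  moreover have "\<forall>x\<in>carrier G. f x = (g \<circ> r) (q x)" using g(2) r(2) by simp
  ultimately show "\<exists>(H :: 'a monoid) S p g.
           topological_group H S \<and> metrizable_space S \<and> perfect_hom G T H S p \<and>
           continuous_map S euclideanreal g \<and> (\<forall>x\<in>carrier G. f x = g (p x))"
    using * by blast
qed

end

(*
  A PM-factorizable group G with a perfect homomorphism p onto a metrizable group H is metrizable
  or PR-factorizable; this dichotomy gives the theorem. Let K be the compact kernel of p. If the
  restrictions to K of the continuous functions on G form a separable subset of C(K), then G is first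
  countable, hence metrizable. If H is second countable, then G is Lindelof, hence PR-factorizable. If
  both fail, there are uncountably many continuous functions on G that are uniformly separated on K and
  a matching uniformly separated set D in H. Gluing translates of these functions along the cosets over
  D gives a single continuous function on G; factoring it through a perfect homomorphism q onto a
  metrizable group makes C(q(K)) non-separable, although q(K) is a compact metrizable space.
*)
theory Submission
  imports Defs
begin

subsection \<open>Pseudometrics from chains of entourages\<close>

text \<open>The dichotomy is applied to the product itself, not to the single factors. Each factor
  satisfies it anyway, which would still allow factors that are only metrizable next to factors that
  are only PR-factorizable; applied to the product it excludes such mixtures, because both
  alternatives descend to factors. Nothing relates the kernel of q to that of p. What counts is that
  q is a homomorphism: if s lies over a point of D, then q(sx) = q(s)q(x), so one map, q restricted
  to K, must carry all the glued functions at once, however many there are. The constant 1/4 stems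
  from the first alternative: a function that is 0 at the unit and at least 1 off a neighbourhood of
  it still jumps by more than 1/2 after errors below 1/4 at both ends. PR-factorizability is used
  through a criterion that mentions no function: a single perfect homomorphism onto a second
  countable group suffices. In this form it passes to factors and to countable products.\<close>

primrec linked :: "(nat \<Rightarrow> 'a \<Rightarrow> 'a \<Rightarrow> bool) \<Rightarrow> 'a \<Rightarrow> (nat \<times> 'a) list \<Rightarrow> 'a \<Rightarrow> bool" where
  "linked E x [] y \<longleftrightarrow> x = y"
| "linked E x (p # ps) y \<longleftrightarrow> E (fst p) x (snd p) \<and> linked E (snd p) ps y"

text \<open>An entry of a chain holds the entourage index of a link and the endpoint of that link.
  Finer entourages are cheaper, so a chain of small total cost can only use fine ones.\<close>

definition chain_cost :: "(nat \<times> 'a) list \<Rightarrow> real" where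
  "chain_cost ps = (\<Sum>p\<leftarrow>ps. (1/2) ^ fst p)"

lemma chain_cost_simps [simp]:
  "chain_cost [] = 0"
  "chain_cost (p # ps) = (1/2) ^ fst p + chain_cost ps"
  "chain_cost (ps @ qs) = chain_cost ps + chain_cost qs"
  by (auto simp: chain_cost_def)

lemma chain_cost_nonneg [simp]: "0 \<le> chain_cost ps"
  by (induction ps) auto

lemma linked_append: "linked E x (ps @ qs) z \<longleftrightarrow> (\<exists>y. linked E x ps y \<and> linked E y qs z)"
  by (induction ps arbitrary: x) auto

text \<open>\<open>a\<close> is the link at which the running cost reaches \<open>c\<close>. It is
  charged to neither side, so both remaining pieces obey their bounds however expensive
  \<open>a\<close> is.\<close>

lemma chain_split:
  assumes "ps \<noteq> []" "0 \<le> c" "c \<le> chain_cost ps"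
  shows "\<exists>ys a zs. ps = ys @ a # zs \<and> chain_cost ys \<le> c \<and> chain_cost zs \<le> chain_cost ps - c"
  using assms
proof (induction ps arbitrary: c)
  case (Cons p ps)
  show ?case
  proof (cases "c \<le> (1/2) ^ fst p")
    case True
    then show ?thesis
      using Cons.prems by (intro exI[of _ "[]"] exI[of _ p] exI[of _ ps]) auto
  next
    case False
    then have "ps \<noteq> []" "0 \<le> c - (1/2) ^ fst p" "c - (1/2) ^ fst p \<le> chain_cost ps"
      using Cons.prems by auto
    then obtain ys a zs where *: "ps = ys @ a # zs" "chain_cost ys \<le> c - (1/2) ^ fst p"
      "chain_cost zs \<le> chain_cost ps - (c - (1/2) ^ fst p)"
      using Cons.IH by blast
    then show ?thesis
      by (intro exI[of _ "p # ys"] exI[of _ a] exI[of _ zs]) auto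
  qed
qed auto

text \<open>The chain argument of the metrization theorem for uniform spaces. Cutting at half the
  cost leaves two shorter chains of cost below \<open>(1/2) ^ Suc m\<close> around one link whose
  own cost is below \<open>(1/2) ^ m\<close>, which forces its index above \<open>m\<close>. These
  are three steps in \<open>E (Suc m)\<close>, whence the threefold composition in
  \<open>comp\<close>.\<close>

lemma linked_imp_entourage:
  assumes refl: "\<And>n x. E n x x"
    and comp: "\<And>n w x y z. E (Suc n) w x \<Longrightarrow> E (Suc n) x y \<Longrightarrow> E (Suc n) y z \<Longrightarrow> E n w z"
  shows "linked E x ps y \<Longrightarrow> chain_cost ps < (1/2) ^ m \<Longrightarrow> E m x y"
proof (induction ps arbitrary: x y m rule: length_induct)
  case (1 ps)
  have mono: "E k a b" if "E l a b" "k \<le> l" for k l a b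
    using that(2,1) by (induction rule: dec_induct) (use refl comp in blast)+
  show ?case
  proof (cases "ps = []")
    case True
    then show ?thesis using 1 refl by simp
  next
    case False
    define s where "s = chain_cost ps"
    obtain ys a zs where ps: "ps = ys @ a # zs" and ys: "chain_cost ys \<le> s/2" and zs: "chain_cost zs \<le> s/2"
      using chain_split[OF False, of "s/2"] by (auto simp: s_def)
    have s: "s < (1/2) ^ m" using 1 by (simp add: s_def)
    obtain u where u: "linked E x ys u" "E (fst a) u (snd a)" "linked E (snd a) zs y"
      using 1 by (auto simp: ps linked_append)
    have IH: "E k v w" if "length qs < length ps" "linked E v qs w" "chain_cost qs < (1/2) ^ k" for qs v w k
      using 1(1) that by blast
    have "E (Suc m) x u"
      using ys s by (intro IH[OF _ u(1)]) (auto simp: ps)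
    moreover have "E (Suc m) (snd a) y"
      using zs s by (intro IH[OF _ u(3)]) (auto simp: ps)
    moreover have "(1/2) ^ fst a \<le> s"
      by (simp add: s_def ps)
    then have "(1/2::real) ^ fst a < (1/2) ^ m" using s by linarith
    then have "m < fst a"
      by (simp add: power_strict_decreasing_iff)
    then have "E (Suc m) u (snd a)"
      using mono[OF u(2)] by simp
    ultimately show ?thesis using comp by blast
  qed
qed

lemma linked_rev:
  assumes sym: "\<And>n x y. E n x y \<Longrightarrow> E n y x"
  shows "linked E x ps y \<Longrightarrow> \<exists>qs. linked E y qs x \<and> chain_cost qs = chain_cost ps"
proof (induction ps arbitrary: x)
  case Nil
  then show ?case by (intro exI[of _ "[]"]) auto
next
  case (Cons p ps)
  then obtain qs where "linked E y qs (snd p)" "chain_cost qs = chain_cost ps"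
    by auto
  then show ?case
    using Cons.prems sym by (intro exI[of _ "qs @ [(fst p, x)]"]) (auto simp: linked_append)
qed

text \<open>Taking the infimum over all chains makes the triangle inequality automatic; the
  substance is that the infimum does not collapse, which is \<open>linked_imp_entourage\<close>. The
  hypothesis \<open>top\<close> links any two points, so that the infimum is over a nonempty
  set.\<close>

lemma pseudometric_of_entourages:
  fixes E :: "nat \<Rightarrow> 'a \<Rightarrow> 'a \<Rightarrow> bool"
  assumes refl: "\<And>n x. E n x x"
    and sym: "\<And>n x y. E n x y \<Longrightarrow> E n y x"
    and comp: "\<And>n w x y z. E (Suc n) w x \<Longrightarrow> E (Suc n) x y \<Longrightarrow> E (Suc n) y z \<Longrightarrow> E n w z"
    and top: "\<And>x y. E 0 x y"
  obtains d :: "'a \<Rightarrow> 'a \<Rightarrow> real"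
  where "\<And>x y. 0 \<le> d x y" "\<And>x. d x x = 0" "\<And>x y. d x y = d y x"
    "\<And>x y z. d x z \<le> d x y + d y z"
    "\<And>n x y. E n x y \<Longrightarrow> d x y \<le> (1/2) ^ n"
    "\<And>n x y. d x y < (1/2) ^ n \<Longrightarrow> E n x y"
proof -
  define C where "C x y = chain_cost ` {ps. linked E x ps y}" for x y
  define d where "d x y = Inf (C x y)" for x y
  have bdd: "bdd_below (C x y)" for x y
    by (rule bdd_belowI[of _ 0]) (auto simp: C_def)
  have step: "(1/2) ^ n \<in> C x y" if "E n x y" for n x y
    unfolding C_def using that by (intro image_eqI[of _ _ "[(n, y)]"]) auto
  have ne: "C x y \<noteq> {}" for x y using step[OF top] by blast
  have le: "d x y \<le> c" if "c \<in> C x y" for x y c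
    unfolding d_def using that bdd by (rule cInf_lower)
  have ex: "\<exists>c\<in>C x y. c < e" if "d x y < e" for x y e
    using that cInf_lessD[OF ne] unfolding d_def by blast
  show ?thesis
  proof (rule that[of d])
    show nn: "0 \<le> d x y" for x y
      unfolding d_def by (rule cInf_greatest[OF ne]) (auto simp: C_def)
    have "0 \<in> C x x" for x
      unfolding C_def by (intro image_eqI[of _ _ "[]"]) auto
    then show "d x x = 0" for x
      using le nn by (metis order_antisym)
    have "C x y \<subseteq> C y x" for x y
      unfolding C_def using linked_rev[of E, OF sym] by (smt (verit) image_iff mem_Collect_eq subsetI)
    then show "d x y = d y x" for x y
      unfolding d_def by (metis order_antisym)
    show "d x z \<le> d x y + d y z" for x y z
    proof (rule field_le_epsilon)
      fix e :: real assume "0 < e"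
      then obtain a b where a: "a \<in> C x y" "a < d x y + e/2" and b: "b \<in> C y z" "b < d y z + e/2"
        using ex[of x y "d x y + e/2"] ex[of y z "d y z + e/2"] by auto
      have "a + b \<in> C x z"
        using a(1) b(1) linked_append unfolding C_def
        by (smt (verit) chain_cost_simps(3) image_iff mem_Collect_eq)
      then show "d x z \<le> d x y + d y z + e"
        using le a b by fastforce
    qed
    show "d x y \<le> (1/2) ^ n" if "E n x y" for n x y
      using step[OF that] le by blast
    show "E n x y" if lt: "d x y < (1/2) ^ n" for n x y
    proof -
      obtain ps where "linked E x ps y" "chain_cost ps < (1/2) ^ n"
        using ex[OF lt] by (auto simp: C_def)
      then show ?thesis
        by (rule linked_imp_entourage[where E = E, rotated 2]) (fact refl comp)+
    qed
  qed
qed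

subsection \<open>Metrizability of topological groups\<close>

locale top_group = group G for G :: "'a monoid" (structure) +
  fixes T :: "'a topology"
  assumes top_group: "topological_group G T"
begin

lemma topspace_eq [simp]: "topspace T = carrier G"
  and Hausdorff: "Hausdorff_space T"
  and continuous_mult: "continuous_map (prod_topology T T) T (\<lambda>(x, y). x \<otimes> y)"
  and continuous_inv: "continuous_map T T (\<lambda>x. inv x)"
  using top_group by (auto simp: topological_group_def)

lemma continuous_map_mult:
  assumes "continuous_map X T f" "continuous_map X T g"
  shows "continuous_map X T (\<lambda>x. f x \<otimes> g x)"
  using continuous_map_compose[OF _ continuous_mult, of X "\<lambda>x. (f x, g x)"] assms
  by (simp add: o_def continuous_map_paired)

lemma continuous_map_inv:
  assumes "continuous_map X T f"
  shows "continuous_map X T (\<lambda>x. inv (f x))"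
  using continuous_map_compose[OF assms continuous_inv] by (simp add: o_def)

lemma continuous_map_const_group: "a \<in> carrier G \<Longrightarrow> continuous_map X T (\<lambda>x. a)"
  by simp

lemma openin_carrier: "openin T U \<Longrightarrow> U \<subseteq> carrier G"
  using openin_subset by fastforce

lemma openin_preimage:
  assumes "continuous_map T T f" "openin T U"
  shows "openin T {x \<in> carrier G. f x \<in> U}"
  using openin_continuous_map_preimage[OF assms] by simp

text \<open>\<open>f\<close> is arbitrary because, besides multiplication, the lemma is applied to
  division, to conjugation by a varying element, and to a product with a fixed left factor.\<close>

lemma nbhd2:
  assumes f: "continuous_map (prod_topology T T) T (\<lambda>(x, y). f x y)" and U: "openin T U"
    and "f \<one> \<one> \<in> U"
  obtains V where "openin T V" "\<one> \<in> V" "\<And>x y. x \<in> V \<Longrightarrow> y \<in> V \<Longrightarrow> f x y \<in> U"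
proof -
  have "openin (prod_topology T T) {z \<in> topspace (prod_topology T T). (\<lambda>(x, y). f x y) z \<in> U}"
    using f U by (rule openin_continuous_map_preimage)
  moreover have "(\<one>, \<one>) \<in> {z \<in> topspace (prod_topology T T). (\<lambda>(x, y). f x y) z \<in> U}"
    using assms by simp
  ultimately obtain A B where "openin T A" "openin T B" "\<one> \<in> A" "\<one> \<in> B"
    "A \<times> B \<subseteq> {z \<in> topspace (prod_topology T T). (\<lambda>(x, y). f x y) z \<in> U}"
    unfolding openin_prod_topology_alt by meson
  then show ?thesis
    by (intro that[of "A \<inter> B"]) auto
qed

lemma nbhd_triple:
  assumes U: "openin T U" "\<one> \<in> U"
  obtains V where "openin T V" "\<one> \<in> V" "\<And>x. x \<in> V \<Longrightarrow> inv x \<in> V"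
    "\<And>x y z. x \<in> V \<Longrightarrow> y \<in> V \<Longrightarrow> z \<in> V \<Longrightarrow> x \<otimes> y \<otimes> z \<in> U"
proof -
  obtain A where A: "openin T A" "\<one> \<in> A" "\<And>x y. x \<in> A \<Longrightarrow> y \<in> A \<Longrightarrow> x \<otimes> y \<in> U"
    using nbhd2[OF continuous_mult U(1)] U by auto
  obtain B where B: "openin T B" "\<one> \<in> B" "\<And>x y. x \<in> B \<Longrightarrow> y \<in> B \<Longrightarrow> x \<otimes> y \<in> A"
    using nbhd2[OF continuous_mult A(1)] A by auto
  define C where "C = A \<inter> B"
  define V where "V = C \<inter> {x \<in> carrier G. inv x \<in> C}"
  show ?thesis
  proof (rule that[of V])
    show "openin T V"
      unfolding V_def C_def using A B openin_preimage[OF continuous_inv] by blast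
    show "\<one> \<in> V" using A B by (simp add: V_def C_def)
    show "inv x \<in> V" if "x \<in> V" for x
      using that by (auto simp: V_def)
    show "x \<otimes> y \<otimes> z \<in> U" if "x \<in> V" "y \<in> V" "z \<in> V" for x y z
      using that A B by (auto simp: V_def C_def)
  qed
qed

lemma openin_translate:
  assumes "openin T U" "a \<in> carrier G"
  shows "openin T {x \<in> carrier G. inv a \<otimes> x \<in> U}"
  using assms by (intro openin_preimage continuous_map_mult) auto

lemma openin_nbhd:
  assumes "openin T U" "a \<in> U"
  obtains V where "openin T V" "\<one> \<in> V" "\<And>x. x \<in> V \<Longrightarrow> a \<otimes> x \<in> U"
proof -
  have a: "a \<in> carrier G" using assms openin_carrier by blast
  then have "openin T {x \<in> carrier G. a \<otimes> x \<in> U}"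
    using openin_translate[OF assms(1), of "inv a"] by simp
  then show ?thesis using a assms by (intro that) auto
qed

text \<open>The pseudometric comes from the left uniformity. Only countably many \<open>W n\<close>
  are prescribed, so \<open>d\<close> is continuous but may be coarser than \<open>T\<close>: a
  constant sequence will give a separating function, a base at the unit a metric.\<close>

lemma left_uniform_pseudometric:
  assumes W: "\<And>n::nat. openin T (W n)" "\<And>n. \<one> \<in> W n"
  obtains d :: "'a \<Rightarrow> 'a \<Rightarrow> real"
  where "\<And>x y. 0 \<le> d x y" "\<And>x. d x x = 0" "\<And>x y. d x y = d y x"
    "\<And>x y z. d x z \<le> d x y + d y z"
    "\<And>e. e > 0 \<Longrightarrow> \<exists>V. openin T V \<and> \<one> \<in> V \<and> (\<forall>x\<in>carrier G. \<forall>y\<in>carrier G. inv x \<otimes> y \<in> V \<longrightarrow> d x y < e)"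
    "\<And>n. \<exists>e>0. \<forall>x\<in>carrier G. \<forall>y\<in>carrier G. d x y < e \<longrightarrow> inv x \<otimes> y \<in> W n"
proof -
  define P where "P = (\<lambda>(n::nat) V. openin T V \<and> \<one> \<in> V \<and> (\<forall>x\<in>V. inv x \<in> V))"
  define Q where "Q = (\<lambda>n V V'. \<forall>x\<in>V'. \<forall>y\<in>V'. \<forall>z\<in>V'. x \<otimes> y \<otimes> z \<in> V \<inter> W n)"
  have "\<exists>U. \<forall>n. P n (U n) \<and> Q n (U n) (U (Suc n))"
  proof (rule dependent_nat_choice)
    show "\<exists>V. P 0 V"
      by (rule exI[of _ "carrier G"]) (use openin_topspace[of T] in \<open>auto simp: P_def\<close>)
    show "\<exists>V'. P (Suc n) V' \<and> Q n V V'" if "P n V" for n V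
      using nbhd_triple[of "V \<inter> W n"] that W unfolding P_def Q_def
      by (metis IntI openin_Int)
  qed
  then obtain U where U: "\<And>n. P n (U n)" "\<And>n. Q n (U n) (U (Suc n))" by blast
  have op: "openin T (U n)" and one: "\<one> \<in> U n" and Uinv: "\<And>x. x \<in> U n \<Longrightarrow> inv x \<in> U n" for n
    using U by (auto simp: P_def)
  have U3: "x \<otimes> y \<otimes> z \<in> U n" "x \<otimes> y \<otimes> z \<in> W n"
    if "x \<in> U (Suc n)" "y \<in> U (Suc n)" "z \<in> U (Suc n)" for n x y z
    using U(2)[of n] that by (auto simp: Q_def)
  \<comment> \<open>Level 0 is universal, as \<open>pseudometric_of_entourages\<close> requires, so
    the index of \<open>U\<close> is shifted by one. The disjunct \<open>x = y\<close> gives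
    reflexivity outside the carrier.\<close>
  define E where "E n x y \<longleftrightarrow> n = 0 \<or> x = y \<or> (x \<in> carrier G \<and> y \<in> carrier G \<and> inv x \<otimes> y \<in> U (n - 1))"
    for n x y
  have E_carrier: "E (Suc n) x y \<longleftrightarrow> inv x \<otimes> y \<in> U n" if "x \<in> carrier G" "y \<in> carrier G" for n x y
    using that one by (auto simp: E_def)
  have E_in: "x = y \<or> (x \<in> carrier G \<and> y \<in> carrier G)" if "E (Suc n) x y" for n x y
    using that by (auto simp: E_def)
  obtain d :: "'a \<Rightarrow> 'a \<Rightarrow> real" where d: "\<And>x y. 0 \<le> d x y" "\<And>x. d x x = 0" "\<And>x y. d x y = d y x"
    "\<And>x y z. d x z \<le> d x y + d y z"
    "\<And>n x y. E n x y \<Longrightarrow> d x y \<le> (1/2) ^ n"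
    "\<And>n x y. d x y < (1/2) ^ n \<Longrightarrow> E n x y"
  proof (rule pseudometric_of_entourages[of E])
    show "E n x x" "E 0 x y" for n x y by (auto simp: E_def)
    show "E n y x" if "E n x y" for n x y
    proof -
      have "inv y \<otimes> x = inv (inv x \<otimes> y)" if "x \<in> carrier G" "y \<in> carrier G"
        using that by (simp add: inv_mult_group)
      then show ?thesis using that Uinv by (auto simp: E_def)
    qed
    show "E n w z" if h: "E (Suc n) w x" "E (Suc n) x y" "E (Suc n) y z" for n w x y z
    proof (cases "n = 0 \<or> w \<notin> carrier G")
      case True
      then show ?thesis using h E_in by (metis E_def)
    next
      case False
      then obtain k where k: "n = Suc k" and w: "w \<in> carrier G" by (cases n) auto
      have c: "x \<in> carrier G" "y \<in> carrier G" "z \<in> carrier G" using w h E_in by blast+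
      have "(inv w \<otimes> x) \<otimes> (inv x \<otimes> y) \<otimes> (inv y \<otimes> z) \<in> U k"
        using h c w by (intro U3) (simp_all add: E_carrier k)
      moreover have "(inv w \<otimes> x) \<otimes> (inv x \<otimes> y) \<otimes> (inv y \<otimes> z) = inv w \<otimes> z"
        using w c by (simp add: m_assoc inv_solve_left)
           (simp add: m_assoc[symmetric])
      ultimately show ?thesis using w c by (simp add: k E_carrier)
    qed
  qed blast
  show ?thesis
  proof (rule that[of d, OF d(1-4)])
    fix e :: real assume "e > 0"
    then obtain n where n: "(1/2) ^ n < e"
      using real_arch_pow_inv[of e "1/2"] by auto
    then have "d x y < e" if "x \<in> carrier G" "y \<in> carrier G" "inv x \<otimes> y \<in> U n" for x y
      using d(1)[of x y] d(5)[of "Suc n" x y] that by (auto simp: E_carrier)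
    then show "\<exists>V. openin T V \<and> \<one> \<in> V \<and> (\<forall>x\<in>carrier G. \<forall>y\<in>carrier G. inv x \<otimes> y \<in> V \<longrightarrow> d x y < e)"
      using op one by blast
  next
    fix n
    \<comment> \<open>The exponent \<open>Suc (Suc n)\<close> tests membership in
      \<open>U (Suc n)\<close>; threefold products from there, here padded with units, land in
      \<open>W n\<close>.\<close>
    have "inv x \<otimes> y \<in> W n" if "x \<in> carrier G" "y \<in> carrier G" "d x y < (1/2) ^ (Suc (Suc n))" for x y
    proof -
      have "inv x \<otimes> y \<in> U (Suc n)" using d(6)[OF that(3)] that by (simp add: E_carrier)
      then have "inv x \<otimes> y \<otimes> \<one> \<otimes> \<one> \<in> W n" using one by (intro U3)
      then show ?thesis using that by simp
    qed
    then show "\<exists>e>0. \<forall>x\<in>carrier G. \<forall>y\<in>carrier G. d x y < e \<longrightarrow> inv x \<otimes> y \<in> W n"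
      by (intro exI[of _ "(1/2) ^ (Suc (Suc n))"]) auto
  qed
qed

end

section \<open>Maximal separated sets and countability in metric spaces\<close>

lemma continuous_map_real_iff:
  "continuous_map X euclideanreal f \<longleftrightarrow>
     (\<forall>x\<in>topspace X. \<forall>e>0. \<exists>U. openin X U \<and> x \<in> U \<and> (\<forall>y\<in>U. \<bar>f y - f x\<bar> < e))"
proof -
  have "continuous_map X Met_TC.mtopology f \<longleftrightarrow>
     (\<forall>x\<in>topspace X. \<forall>e>0. \<exists>U. openin X U \<and> x \<in> U \<and> (\<forall>y\<in>U. f y \<in> Met_TC.mball (f x) e))"
    by (rule Met_TC.continuous_map_to_metric)
  then show ?thesis
    by (simp add: dist_real_def abs_minus_commute)
qed

text \<open>Zorn's lemma, for an abstract relation because it serves twice: for points of a metric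
  space at distance at least \<open>e\<close>, and for functions that differ by at least 1/4
  somewhere on a compact kernel.\<close>

lemma maximal_separated:
  fixes R :: "'a \<Rightarrow> 'a \<Rightarrow> bool"
  assumes "\<And>x y. R x y \<Longrightarrow> R y x"
  obtains S where "S \<subseteq> X" "pairwise R S" "\<And>x. x \<in> X \<Longrightarrow> x \<notin> S \<Longrightarrow> \<exists>s\<in>S. \<not> R s x"
proof -
  obtain M where M': "M \<in> {S. S \<subseteq> X \<and> pairwise R S}"
    and max': "\<forall>S\<in>{S. S \<subseteq> X \<and> pairwise R S}. M \<subseteq> S \<longrightarrow> S = M"
  proof (rule bexE[OF subset_Zorn_nonempty])
    show "{S. S \<subseteq> X \<and> pairwise R S} \<noteq> {}" by (auto intro!: exI[of _ "{}"])
    show "\<Union>C \<in> {S. S \<subseteq> X \<and> pairwise R S}"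
      if "C \<noteq> {}" "subset.chain {S. S \<subseteq> X \<and> pairwise R S} C" for C
    proof -
      have "pairwise R (\<Union>C)"
      proof (rule pairwiseI)
        fix x y assume "x \<in> \<Union>C" "y \<in> \<Union>C" "x \<noteq> y"
        then obtain A B where AB: "A \<in> C" "B \<in> C" "x \<in> A" "y \<in> B" by blast
        then have "A \<subseteq> B \<or> B \<subseteq> A" using that(2) by (meson subset_chain_def)
        then obtain D where "D \<in> C" "x \<in> D" "y \<in> D" using AB by blast
        then show "R x y" using that(2) \<open>x \<noteq> y\<close> unfolding subset_chain_def pairwise_def by blast
      qed
      then show ?thesis using that(2) unfolding subset_chain_def by blast
    qed
  qed blast
  then have M: "M \<subseteq> X" "pairwise R M"
    and max: "\<And>S. S \<subseteq> X \<Longrightarrow> pairwise R S \<Longrightarrow> M \<subseteq> S \<Longrightarrow> S = M" by simp_all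
  show ?thesis
  proof (rule that[OF M])
    fix x assume x: "x \<in> X" "x \<notin> M"
    show "\<exists>s\<in>M. \<not> R s x"
    proof (rule ccontr)
      assume "\<not> ?thesis"
      then have "pairwise R (insert x M)" using M(2) assms by (auto simp: pairwise_insert)
      then show False using max[of "insert x M"] x M by blast
    qed
  qed
qed

text \<open>Balls of radius \<open>1 / Suc n\<close> about the points of the n-th net form a base.
  In this form the failure of second countability yields a radius at which no countable net exists,
  hence an uncountable separated set.\<close>

lemma (in Metric_space) second_countable_if_nets:
  assumes "\<And>e. e > 0 \<Longrightarrow> \<exists>C. countable C \<and> C \<subseteq> M \<and> (\<forall>x\<in>M. \<exists>c\<in>C. d c x < e)"
  shows "second_countable mtopology"
proof -
  have "\<exists>C. \<forall>n. countable (C n) \<and> C n \<subseteq> M \<and> (\<forall>x\<in>M. \<exists>c\<in>C n. d c x < 1 / real (Suc n))"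
    using assms by (intro choice allI) auto
  then obtain C where C: "\<And>n. countable (C n)" "\<And>n. C n \<subseteq> M"
    "\<And>n x. x \<in> M \<Longrightarrow> \<exists>c\<in>C n. d c x < 1 / real (Suc n)" by metis
  show ?thesis
    unfolding second_countable_def
  proof (intro exI conjI ballI allI impI)
    show "countable (\<Union>n. (\<lambda>c. mball c (1 / real (Suc n))) ` C n)"
      using C by auto
    show "openin mtopology V" if "V \<in> (\<Union>n. (\<lambda>c. mball c (1 / real (Suc n))) ` C n)" for V
      using that by auto
    fix U x assume Ux: "openin mtopology U \<and> x \<in> U"
    then obtain r where r: "r > 0" "mball x r \<subseteq> U" and xM: "x \<in> M"
      unfolding openin_mtopology by blast
    obtain n where n: "1 / real (Suc n) < r / 2"
      using r nat_approx_posE by (metis half_gt_zero)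
    obtain c where c: "c \<in> C n" "d c x < 1 / real (Suc n)" using C(3)[OF xM] by blast
    have cM: "c \<in> M" using c C by blast
    have "mball c (1 / real (Suc n)) \<subseteq> mball x r"
    proof
      fix y assume y: "y \<in> mball c (1 / real (Suc n))"
      then have "d x y \<le> d c x + d c y" using triangle[of x c y] cM xM by (simp add: commute)
      then show "y \<in> mball x r" using y c n xM by auto
    qed
    then show "\<exists>V\<in>\<Union>n. (\<lambda>c. mball c (1 / real (Suc n))) ` C n. x \<in> V \<and> V \<subseteq> U"
      using c cM xM r by (intro bexI[of _ "mball c (1 / real (Suc n))"]) auto
  qed
qed

lemma metrizable_Lindelof_imp_second_countable:
  assumes "metrizable_space X" "Lindelof_space X"
  shows "second_countable X"
proof -
  obtain M d where "Metric_space M d" and X: "X = Metric_space.mtopology M d"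
    using assms(1) by (auto simp: metrizable_space_def)
  then interpret Metric_space M d by simp
  show ?thesis
    unfolding X
  proof (rule second_countable_if_nets)
    fix e :: real assume "e > 0"
    then have "\<Union>((\<lambda>c. mball c e) ` M) = topspace X" by (auto simp: X)
    then obtain V where V: "countable V" "V \<subseteq> (\<lambda>c. mball c e) ` M" "\<Union>V = topspace X"
      using Lindelof_spaceD[OF assms(2), of "(\<lambda>c. mball c e) ` M"] by (auto simp: X)
    then obtain C where "C \<subseteq> M" "countable C" "V = (\<lambda>c. mball c e) ` C"
      by (meson countable_subset_image)
    moreover have "\<exists>c\<in>C. d c x < e" if "x \<in> M" for x
    proof -
      have "x \<in> (\<Union>c\<in>C. mball c e)" using that V(3) calculation by (simp add: X)
      then show ?thesis by auto
    qed
    ultimately show "\<exists>C. countable C \<and> C \<subseteq> M \<and> (\<forall>x\<in>M. \<exists>c\<in>C. d c x < e)"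
      by blast
  qed
qed

section \<open>Complete regularity and metrizability from neighbourhoods of the unit\<close>

context top_group
begin

text \<open>Complete regularity at the unit: \<open>h\<close> is the distance from
  \<open>\<one>\<close> in the pseudometric for the constant sequence \<open>W\<close>, rescaled so
  that the threshold that guarantees membership in \<open>W\<close> becomes 1.\<close>

lemma ex_continuous_separating:
  assumes W: "openin T W" "\<one> \<in> W"
  obtains h where "continuous_map T euclideanreal h" "h \<one> = 0" "\<And>x. x \<in> carrier G \<Longrightarrow> x \<notin> W \<Longrightarrow> 1 \<le> h x"
proof -
  obtain d :: "'a \<Rightarrow> 'a \<Rightarrow> real"
    where d: "\<And>x y. 0 \<le> d x y" "\<And>x. d x x = 0" "\<And>x y. d x y = d y x" "\<And>x y z. d x z \<le> d x y + d y z"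
    and small: "\<And>e. e > 0 \<Longrightarrow> \<exists>V. openin T V \<and> \<one> \<in> V \<and> (\<forall>x\<in>carrier G. \<forall>y\<in>carrier G. inv x \<otimes> y \<in> V \<longrightarrow> d x y < e)"
    and "\<exists>e>0. \<forall>x\<in>carrier G. \<forall>y\<in>carrier G. d x y < e \<longrightarrow> inv x \<otimes> y \<in> W"
    using left_uniform_pseudometric[of "\<lambda>_. W"] W by metis
  then obtain e where e: "e > 0" "\<And>x y. x \<in> carrier G \<Longrightarrow> y \<in> carrier G \<Longrightarrow> d x y < e \<Longrightarrow> inv x \<otimes> y \<in> W"
    by blast
  show ?thesis
  proof (rule that[of "\<lambda>x. d \<one> x / e"])
    show "continuous_map T euclideanreal (\<lambda>x. d \<one> x / e)"
      unfolding continuous_map_real_iff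
    proof (intro ballI allI impI)
      fix x and r :: real assume x: "x \<in> topspace T" and r: "r > 0"
      obtain V where V: "openin T V" "\<one> \<in> V"
        "\<And>x y. x \<in> carrier G \<Longrightarrow> y \<in> carrier G \<Longrightarrow> inv x \<otimes> y \<in> V \<Longrightarrow> d x y < r * e"
        using small[of "r * e"] r e by (metis mult_pos_pos)
      define U where "U = {y \<in> carrier G. inv x \<otimes> y \<in> V}"
      have "openin T U" unfolding U_def using V(1) x by (intro openin_translate) auto
      moreover have "x \<in> U" using x V by (simp add: U_def)
      moreover have "\<bar>d \<one> y / e - d \<one> x / e\<bar> < r" if "y \<in> U" for y
      proof -
        have "d x y < r * e" using V(3)[of x y] that x by (simp add: U_def)
        then have "\<bar>d \<one> y - d \<one> x\<bar> < r * e"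
          using d(4)[of \<one> y x] d(4)[of \<one> x y] d(3)[of x y] by linarith
        then have "\<bar>d \<one> y - d \<one> x\<bar> / e < r" using e(1) by (simp add: pos_divide_less_eq)
        then show ?thesis using e(1) by (simp add: diff_divide_distrib[symmetric])
      qed
      ultimately show "\<exists>U. openin T U \<and> x \<in> U \<and> (\<forall>y\<in>U. \<bar>d \<one> y / e - d \<one> x / e\<bar> < r)" by blast
    qed
    show "d \<one> \<one> / e = 0" using d by simp
    show "1 \<le> d \<one> x / e" if "x \<in> carrier G" "x \<notin> W" for x
      using e(2)[of \<one> x] that e(1) by (auto simp: le_divide_eq not_less[symmetric])
  qed
qed

text \<open>The Birkhoff-Kakutani theorem. With the base as the sequence of prescribed
  neighbourhoods, the pseudometric separates points because \<open>T\<close> is Hausdorff, and its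
  balls and the translates of base sets refine each other.\<close>

lemma metrizable_if_countable_base_one:
  assumes B: "countable \<B>" "\<And>W. W \<in> \<B> \<Longrightarrow> openin T W \<and> \<one> \<in> W"
    and base: "\<And>U. openin T U \<Longrightarrow> \<one> \<in> U \<Longrightarrow> \<exists>W\<in>\<B>. W \<subseteq> U"
  shows "metrizable_space T"
proof -
  have ne: "\<B> \<noteq> {}" using base[OF openin_topspace] by auto
  define W where "W = from_nat_into \<B>"
  have rW: "range W = \<B>" unfolding W_def using ne B(1) by (rule range_from_nat_into)
  then have W: "openin T (W n)" "\<one> \<in> W n" for n using B(2) by blast+
  have W3: "\<exists>n. W n \<subseteq> U" if "openin T U" "\<one> \<in> U" for U
    using base[OF that] rW by auto
  obtain d :: "'a \<Rightarrow> 'a \<Rightarrow> real"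
    where d: "\<And>x y. 0 \<le> d x y" "\<And>x. d x x = 0" "\<And>x y. d x y = d y x" "\<And>x y z. d x z \<le> d x y + d y z"
    and small: "\<And>e. e > 0 \<Longrightarrow> \<exists>V. openin T V \<and> \<one> \<in> V \<and> (\<forall>x\<in>carrier G. \<forall>y\<in>carrier G. inv x \<otimes> y \<in> V \<longrightarrow> d x y < e)"
    and large: "\<And>n. \<exists>e>0. \<forall>x\<in>carrier G. \<forall>y\<in>carrier G. d x y < e \<longrightarrow> inv x \<otimes> y \<in> W n"
    using left_uniform_pseudometric[of W] W by metis
  interpret M: Metric_space "carrier G" d
  proof
    show "d x y = 0 \<longleftrightarrow> x = y" if x: "x \<in> carrier G" and y: "y \<in> carrier G" for x y
    proof
      assume "d x y = 0"
      then have in_W: "inv x \<otimes> y \<in> W n" for n using large[of n] x y by force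
      show "x = y"
      proof (rule ccontr)
        assume "x \<noteq> y"
        then have "inv x \<otimes> y \<noteq> \<one>" using x y by (metis inv_closed inv_equality inv_inv)
        then obtain U where "openin T U" "\<one> \<in> U" "inv x \<otimes> y \<notin> U"
          using Hausdorff x y unfolding Hausdorff_space_def disjnt_iff
          by (metis inv_closed m_closed one_closed topspace_eq)
        then show False using W3 in_W by blast
      qed
    qed (use d in simp)
  qed (rule d)+
  have "M.mtopology = T"
    unfolding topology_eq
  proof (intro allI iffI)
    fix U assume U: "openin T U"
    show "openin M.mtopology U"
      unfolding M.openin_mtopology
    proof (intro conjI allI impI)
      show "U \<subseteq> carrier G" using U openin_carrier by blast
      fix x assume x: "x \<in> U"
      then have xc: "x \<in> carrier G" using U openin_carrier by blast
      obtain V where V: "openin T V" "\<one> \<in> V" "\<And>v. v \<in> V \<Longrightarrow> x \<otimes> v \<in> U"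
        using openin_nbhd[OF U x] by blast
      obtain n where n: "W n \<subseteq> V" using W3 V by blast
      obtain e where e: "e > 0" "\<And>y. y \<in> carrier G \<Longrightarrow> d x y < e \<Longrightarrow> inv x \<otimes> y \<in> W n"
        using large xc by meson
      have "M.mball x e \<subseteq> U"
      proof
        fix y assume "y \<in> M.mball x e"
        then have "y \<in> carrier G" "x \<otimes> (inv x \<otimes> y) \<in> U" using e n V by auto
        then show "y \<in> U" using xc by (simp add: m_assoc[symmetric])
      qed
      then show "\<exists>r>0. M.mball x r \<subseteq> U" using e by blast
    qed
  next
    fix U assume U: "openin M.mtopology U"
    show "openin T U"
    proof (subst openin_subopen, intro ballI)
      fix x assume x: "x \<in> U"
      then obtain r where r: "r > 0" "M.mball x r \<subseteq> U" and xc: "x \<in> carrier G"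
        using U unfolding M.openin_mtopology by blast
      obtain V where V: "openin T V" "\<one> \<in> V"
        "\<And>y. y \<in> carrier G \<Longrightarrow> inv x \<otimes> y \<in> V \<Longrightarrow> d x y < r"
        using small[OF r(1)] xc by blast
      have "{y \<in> carrier G. inv x \<otimes> y \<in> V} \<subseteq> U" using V(3) xc r(2) by auto
      then show "\<exists>S. openin T S \<and> x \<in> S \<and> S \<subseteq> U"
        using openin_translate[OF V(1) xc] xc V(2) by (intro exI[of _ "{y \<in> carrier G. inv x \<otimes> y \<in> V}"]) auto
    qed
  qed
  then show ?thesis using M.metrizable_space_mtopology by simp
qed

lemma second_countable_imp_metrizable:
  assumes "second_countable T"
  shows "metrizable_space T"
proof -
  obtain \<B> where \<B>: "countable \<B>" "\<And>V. V \<in> \<B> \<Longrightarrow> openin T V"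
    "\<And>U x. openin T U \<Longrightarrow> x \<in> U \<Longrightarrow> \<exists>V\<in>\<B>. x \<in> V \<and> V \<subseteq> U"
    using assms unfolding second_countable_def by metis
  show ?thesis
  proof (rule metrizable_if_countable_base_one[of "{V \<in> \<B>. \<one> \<in> V}"])
    show "\<exists>W\<in>{V \<in> \<B>. \<one> \<in> V}. W \<subseteq> U" if "openin T U" "\<one> \<in> U" for U
      using \<B>(3)[OF that] by blast
  qed (use \<B> in auto)
qed

end

subsection \<open>Quotients defined by families of neighbourhoods\<close>

lemma topological_group_imp_top_group: "topological_group G T \<Longrightarrow> top_group G T"
  by (simp add: topological_group_def top_group_def top_group_axioms_def)

lemma (in group) mult_inv_cancel [simp]:
  assumes "x \<in> carrier G" "y \<in> carrier G"
  shows "x \<otimes> (inv x \<otimes> y) = y" "inv x \<otimes> (x \<otimes> y) = y"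
  using assms by (simp_all add: m_assoc[symmetric])

text \<open>A filter base at the unit for a possibly coarser group topology. \<open>divide\<close>
  and \<open>conjugate\<close> are the usual axioms; separation is not among them and is restored by
  dividing out the intersection of \<Gamma>. The benefit is that a countable \<Gamma> gives a
  metrizable quotient.\<close>

locale nbhd_system = top_group +
  fixes \<Gamma> :: "'a set set"
  assumes nonempty: "\<Gamma> \<noteq> {}"
    and nbhd: "\<And>U. U \<in> \<Gamma> \<Longrightarrow> openin T U" "\<And>U. U \<in> \<Gamma> \<Longrightarrow> \<one> \<in> U"
    and directed: "\<And>U V. U \<in> \<Gamma> \<Longrightarrow> V \<in> \<Gamma> \<Longrightarrow> \<exists>W\<in>\<Gamma>. W \<subseteq> U \<inter> V"
    and divide: "\<And>U. U \<in> \<Gamma> \<Longrightarrow> \<exists>V\<in>\<Gamma>. \<forall>v\<in>V. \<forall>w\<in>V. v \<otimes> inv w \<in> U"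
    and conjugate: "\<And>U x. U \<in> \<Gamma> \<Longrightarrow> x \<in> carrier G \<Longrightarrow> \<exists>V\<in>\<Gamma>. \<forall>v\<in>V. inv x \<otimes> v \<otimes> x \<in> U"
begin

lemma nbhd_carrier: "U \<in> \<Gamma> \<Longrightarrow> v \<in> U \<Longrightarrow> v \<in> carrier G"
  using nbhd(1) openin_carrier by blast

lemma invert:
  assumes "U \<in> \<Gamma>"
  shows "\<exists>V\<in>\<Gamma>. \<forall>v\<in>V. inv v \<in> U"
proof -
  obtain V where V: "V \<in> \<Gamma>" "\<And>v w. v \<in> V \<Longrightarrow> w \<in> V \<Longrightarrow> v \<otimes> inv w \<in> U" using divide[OF assms] by blast
  have "inv v \<in> U" if "v \<in> V" for v
    using V(2)[OF nbhd(2)[OF V(1)] that] nbhd_carrier[OF V(1) that] by simp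
  then show ?thesis using V(1) by blast
qed

lemma multiply:
  assumes "U \<in> \<Gamma>"
  shows "\<exists>V\<in>\<Gamma>. \<forall>v\<in>V. \<forall>w\<in>V. v \<otimes> w \<in> U"
proof -
  obtain V where V: "V \<in> \<Gamma>" "\<And>v w. v \<in> V \<Longrightarrow> w \<in> V \<Longrightarrow> v \<otimes> inv w \<in> U" using divide[OF assms] by blast
  obtain V' where V': "V' \<in> \<Gamma>" "\<And>v. v \<in> V' \<Longrightarrow> inv v \<in> V" using invert[OF V(1)] by blast
  obtain W where W: "W \<in> \<Gamma>" "W \<subseteq> V \<inter> V'" using directed V V' by blast
  have "v \<otimes> w \<in> U" if "v \<in> W" "w \<in> W" for v w
    using V(2)[of v "inv w"] V'(2)[of w] W that nbhd_carrier[OF W(1)] by auto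
  then show ?thesis using W by blast
qed

definition core :: "'a set" where "core = \<Inter>\<Gamma>"

lemma core_normal: "core \<lhd> G"
  unfolding normal_inv_iff
proof (intro conjI ballI subgroupI)
  show "core \<subseteq> carrier G" using nonempty nbhd_carrier by (auto simp: core_def)
  then have car: "x \<in> carrier G" if "x \<in> core" for x using that by blast
  have "\<one> \<in> core" using nbhd(2) by (simp add: core_def)
  then show "core \<noteq> {}" by blast
  show "inv a \<in> core" if "a \<in> core" for a
    using that invert unfolding core_def by blast
  show "a \<otimes> b \<in> core" if "a \<in> core" "b \<in> core" for a b
    using that multiply unfolding core_def by blast
  show "x \<otimes> h \<otimes> inv x \<in> core" if "x \<in> carrier G" "h \<in> core" for x h
    unfolding core_def
  proof
    fix U assume "U \<in> \<Gamma>"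
    then have "\<exists>V\<in>\<Gamma>. \<forall>v\<in>V. inv (inv x) \<otimes> v \<otimes> inv x \<in> U"
      by (rule conjugate) (use that(1) in simp)
    then obtain V where "V \<in> \<Gamma>" "\<forall>v\<in>V. inv (inv x) \<otimes> v \<otimes> inv x \<in> U" ..
    then show "x \<otimes> h \<otimes> inv x \<in> U" using that by (auto simp: core_def)
  qed
qed

sublocale core: normal core G by (rule core_normal)

definition proj :: "'a \<Rightarrow> 'a set" where "proj x = core #> x"

lemma carrier_quotient: "carrier (G Mod core) = proj ` carrier G"
  by (simp add: carrier_FactGroup proj_def)

lemma proj_mult: "x \<in> carrier G \<Longrightarrow> y \<in> carrier G \<Longrightarrow> proj x \<otimes>\<^bsub>G Mod core\<^esub> proj y = proj (x \<otimes> y)"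
  by (simp add: proj_def core.rcos_sum)

lemma proj_one: "proj \<one> = \<one>\<^bsub>G Mod core\<^esub>"
  using core.subset by (simp add: proj_def)

lemma proj_hom: "proj \<in> hom G (G Mod core)"
  using core.r_coset_hom_Mod by (simp add: proj_def [abs_def])

lemma proj_inv: "x \<in> carrier G \<Longrightarrow> inv\<^bsub>G Mod core\<^esub> (proj x) = proj (inv x)"
  by (metis core.factorgroup_is_group carrier_quotient group.inv_equality image_eqI inv_closed l_inv
      proj_mult proj_one)

lemma proj_eq_iff:
  assumes x: "x \<in> carrier G" and y: "y \<in> carrier G"
  shows "proj x = proj y \<longleftrightarrow> inv x \<otimes> y \<in> core"
proof
  assume eq: "proj x = proj y"
  have "proj (inv x \<otimes> y) = proj (inv x \<otimes> x)"
    using x y eq proj_mult by (metis inv_closed)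
  then have "core #> (inv x \<otimes> y) = core"
    using x by (simp add: proj_one) (simp add: proj_def)
  then show "inv x \<otimes> y \<in> core"
    using x y coset_join1[OF _ _ core.subgroup_axioms] by auto
next
  assume h: "inv x \<otimes> y \<in> core"
  then have "proj (inv x \<otimes> y) = proj \<one>"
    using coset_join2[OF _ core.subgroup_axioms h] x y by (simp add: proj_one) (simp add: proj_def)
  then have "proj (x \<otimes> (inv x \<otimes> y)) = proj (x \<otimes> \<one>)"
    using x y proj_mult by (metis inv_closed m_closed one_closed)
  then show "proj x = proj y" using x y by simp
qed

text \<open>Neighbourhoods of a coset are read off from translates of members of \<Gamma> only, so
  this may be coarser than the quotient topology of \<open>T\<close>. Testing all representatives
  \<open>x\<close> avoids choosing one.\<close>

definition quotient_open :: "'a set set \<Rightarrow> bool" where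
  "quotient_open X \<longleftrightarrow> X \<subseteq> proj ` carrier G \<and>
     (\<forall>x\<in>carrier G. proj x \<in> X \<longrightarrow> (\<exists>V\<in>\<Gamma>. \<forall>v\<in>V. proj (x \<otimes> v) \<in> X))"

definition quotient_top :: "'a set topology" where
  "quotient_top = topology quotient_open"

lemma openin_quotient_top: "openin quotient_top = quotient_open"
proof -
  have "istopology quotient_open"
    unfolding istopology_def
  proof (intro conjI allI impI)
    fix X Y assume X: "quotient_open X" and Y: "quotient_open Y"
    show "quotient_open (X \<inter> Y)"
      unfolding quotient_open_def
    proof (intro conjI ballI impI)
      show "X \<inter> Y \<subseteq> proj ` carrier G" using X by (auto simp: quotient_open_def)
      fix x assume x: "x \<in> carrier G" "proj x \<in> X \<inter> Y"
      obtain U where U: "U \<in> \<Gamma>" "\<forall>v\<in>U. proj (x \<otimes> v) \<in> X" using X x unfolding quotient_open_def by blast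
      obtain V where V: "V \<in> \<Gamma>" "\<forall>v\<in>V. proj (x \<otimes> v) \<in> Y" using Y x unfolding quotient_open_def by blast
      show "\<exists>V\<in>\<Gamma>. \<forall>v\<in>V. proj (x \<otimes> v) \<in> X \<inter> Y" using directed[OF U(1) V(1)] U V by blast
    qed
  next
    fix \<K> assume \<K>: "\<forall>K\<in>\<K>. quotient_open K"
    show "quotient_open (\<Union>\<K>)"
      unfolding quotient_open_def
    proof (intro conjI ballI impI)
      show "\<Union>\<K> \<subseteq> proj ` carrier G" using \<K> unfolding quotient_open_def by blast
      fix x assume x: "x \<in> carrier G" "proj x \<in> \<Union>\<K>"
      then obtain K where K: "K \<in> \<K>" "proj x \<in> K" by blast
      then obtain V where "V \<in> \<Gamma>" "\<forall>v\<in>V. proj (x \<otimes> v) \<in> K" using \<K> x(1) unfolding quotient_open_def by blast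
      then show "\<exists>V\<in>\<Gamma>. \<forall>v\<in>V. proj (x \<otimes> v) \<in> \<Union>\<K>" using K by blast
    qed
  qed
  then show ?thesis by (simp add: quotient_top_def)
qed

lemma quotient_openD:
  assumes "openin quotient_top X" "x \<in> carrier G" "proj x \<in> X"
  shows "\<exists>V\<in>\<Gamma>. \<forall>v\<in>V. proj (x \<otimes> v) \<in> X"
  using assms by (simp add: openin_quotient_top quotient_open_def)

lemma topspace_quotient_top [simp]: "topspace quotient_top = proj ` carrier G"
proof -
  have "quotient_open (proj ` carrier G)"
    using nonempty nbhd_carrier unfolding quotient_open_def by blast
  moreover have "X \<subseteq> proj ` carrier G" if "quotient_open X" for X
    using that by (simp add: quotient_open_def)
  ultimately show ?thesis
    unfolding topspace_def openin_quotient_top by blast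
qed

lemma continuous_proj: "continuous_map T quotient_top proj"
  unfolding continuous_map
proof (intro conjI allI impI)
  show "proj ` topspace T \<subseteq> topspace quotient_top" by simp
  fix X assume X: "openin quotient_top X"
  show "openin T {x \<in> topspace T. proj x \<in> X}"
  proof (subst openin_subopen, intro ballI)
    fix x assume "x \<in> {x \<in> topspace T. proj x \<in> X}"
    then have x: "x \<in> carrier G" "proj x \<in> X" by auto
    then obtain V where V: "V \<in> \<Gamma>" "\<And>v. v \<in> V \<Longrightarrow> proj (x \<otimes> v) \<in> X"
      using quotient_openD[OF X] by blast
    have "proj y \<in> X" if "y \<in> carrier G" "inv x \<otimes> y \<in> V" for y
      using V(2)[OF that(2)] x(1) that(1) by simp
    then show "\<exists>S. openin T S \<and> x \<in> S \<and> S \<subseteq> {x \<in> topspace T. proj x \<in> X}"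
      using openin_translate[OF nbhd(1)[OF V(1)] x(1)] x nbhd(2)[OF V(1)]
      by (intro exI[of _ "{y \<in> carrier G. inv x \<otimes> y \<in> V}"]) auto
  qed
qed

text \<open>Not every member of \<open>\<Gamma>\<close> has an open image in the coarser topology, so we pass to
  its interior there.\<close>

lemma quotient_nbhd:
  assumes x: "x \<in> carrier G" and V: "V \<in> \<Gamma>"
  obtains X where "openin quotient_top X" "proj x \<in> X"
    "\<And>y. y \<in> carrier G \<Longrightarrow> proj y \<in> X \<Longrightarrow> inv x \<otimes> y \<in> V"
proof -
  define Y where "Y = {y \<in> carrier G. \<exists>W\<in>\<Gamma>. \<forall>w\<in>W. inv x \<otimes> (y \<otimes> w) \<in> V}"
  have Ystep: "\<exists>W\<in>\<Gamma>. \<forall>w\<in>W. y \<otimes> w \<in> Y" if y: "y \<in> Y" for y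
  proof -
    obtain W where W: "W \<in> \<Gamma>" "\<And>w. w \<in> W \<Longrightarrow> inv x \<otimes> (y \<otimes> w) \<in> V" and yc: "y \<in> carrier G"
      using y unfolding Y_def by blast
    obtain W' where W': "W' \<in> \<Gamma>" "\<And>v w. v \<in> W' \<Longrightarrow> w \<in> W' \<Longrightarrow> v \<otimes> w \<in> W"
      using multiply[OF W(1)] by blast
    have "y \<otimes> v \<in> Y" if v: "v \<in> W'" for v
    proof -
      have "inv x \<otimes> (y \<otimes> v \<otimes> w) \<in> V" if "w \<in> W'" for w
        using W(2)[OF W'(2)[OF v that]] nbhd_carrier[OF W'(1)] v that yc by (simp add: m_assoc)
      then show ?thesis using W'(1) yc nbhd_carrier[OF W'(1) v] unfolding Y_def by blast
    qed
    then show ?thesis using W'(1) by blast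
  qed
  \<comment> \<open>\<open>Y\<close> is a union of cosets because \<open>core\<close> lies in every
    member of \<Gamma>. Hence a point whose coset lies in the image of \<open>Y\<close> belongs to
    \<open>Y\<close> itself.\<close>
  have sat: "z \<in> Y" if "y \<in> Y" "z \<in> carrier G" "proj y = proj z" for y z
  proof -
    have yc: "y \<in> carrier G" using that(1) by (simp add: Y_def)
    have "inv y \<otimes> z \<in> core" using that yc proj_eq_iff by blast
    then have "y \<otimes> (inv y \<otimes> z) \<in> Y" using Ystep[OF that(1)] unfolding core_def by blast
    then show ?thesis using yc that(2) by simp
  qed
  show ?thesis
  proof (rule that[of "proj ` Y"])
    show "openin quotient_top (proj ` Y)"
      unfolding openin_quotient_top quotient_open_def
    proof (intro conjI ballI impI)
      show "proj ` Y \<subseteq> proj ` carrier G" by (auto simp: Y_def)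
      fix y assume "y \<in> carrier G" "proj y \<in> proj ` Y"
      then have "y \<in> Y" using sat by auto
      from Ystep[OF this] obtain W where W: "W \<in> \<Gamma>" "\<forall>w\<in>W. y \<otimes> w \<in> Y" ..
      show "\<exists>V\<in>\<Gamma>. \<forall>v\<in>V. proj (y \<otimes> v) \<in> proj ` Y"
        by (rule bexI[OF _ W(1)]) (use W(2) in simp)
    qed
    have "inv x \<otimes> (x \<otimes> w) \<in> V" if "w \<in> V" for w
      using that nbhd_carrier[OF V] x by simp
    then have "\<exists>W\<in>\<Gamma>. \<forall>w\<in>W. inv x \<otimes> (x \<otimes> w) \<in> V" using V by (intro bexI ballI)
    then have "x \<in> Y" using x by (simp only: Y_def mem_Collect_eq simp_thms)
    then show "proj x \<in> proj ` Y" by (rule imageI)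
    show "inv x \<otimes> y \<in> V" if "y \<in> carrier G" "proj y \<in> proj ` Y" for y
    proof -
      have "y \<in> Y" using sat that by auto
      then have "\<exists>W\<in>\<Gamma>. \<forall>w\<in>W. inv x \<otimes> (y \<otimes> w) \<in> V" by (simp add: Y_def)
      then obtain W where W: "W \<in> \<Gamma>" "\<forall>w\<in>W. inv x \<otimes> (y \<otimes> w) \<in> V" ..
      then have "inv x \<otimes> (y \<otimes> \<one>) \<in> V" using nbhd(2)[OF W(1)] by blast
      then show ?thesis using that by simp
    qed
  qed
qed

text \<open>Everything is checked on representatives in \<open>G\<close>:
  \<open>quotient_nbhd\<close> turns closeness of \<open>proj y\<close> to \<open>proj x\<close>
  into membership of \<open>inv x \<otimes> y\<close> in a member of \<Gamma>.\<close>

lemma quotient_top_group: "topological_group (G Mod core) quotient_top"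
  unfolding topological_group_def
proof (intro conjI)
  show "group (G Mod core)" by (rule core.factorgroup_is_group)
  show "topspace quotient_top = carrier (G Mod core)" by (simp add: carrier_quotient)
  show "Hausdorff_space quotient_top"
    unfolding Hausdorff_space_def
  proof (intro allI impI)
    fix a b assume ab: "a \<in> topspace quotient_top \<and> b \<in> topspace quotient_top \<and> a \<noteq> b"
    then obtain x y where xy: "x \<in> carrier G" "y \<in> carrier G" "a = proj x" "b = proj y" by auto
    then obtain U where U: "U \<in> \<Gamma>" "inv x \<otimes> y \<notin> U"
      using ab proj_eq_iff[of x y] by (auto simp: core_def)
    obtain V where V: "V \<in> \<Gamma>" "\<And>v w. v \<in> V \<Longrightarrow> w \<in> V \<Longrightarrow> v \<otimes> inv w \<in> U"
      using divide[OF U(1)] by metis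
    obtain A where A: "openin quotient_top A" "proj x \<in> A"
      "\<And>z. z \<in> carrier G \<Longrightarrow> proj z \<in> A \<Longrightarrow> inv x \<otimes> z \<in> V" using quotient_nbhd[OF xy(1) V(1)] by blast
    obtain B where B: "openin quotient_top B" "proj y \<in> B"
      "\<And>z. z \<in> carrier G \<Longrightarrow> proj z \<in> B \<Longrightarrow> inv y \<otimes> z \<in> V" using quotient_nbhd[OF xy(2) V(1)] by blast
    have "disjnt A B"
      unfolding disjnt_iff
    proof (intro allI notI)
      fix c assume c: "c \<in> A \<and> c \<in> B"
      then obtain z where z: "z \<in> carrier G" "c = proj z" using openin_subset[OF A(1)] by auto
      have "(inv x \<otimes> z) \<otimes> inv (inv y \<otimes> z) \<in> U" using c z A B V by blast
      moreover have "(inv x \<otimes> z) \<otimes> inv (inv y \<otimes> z) = inv x \<otimes> y"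
      proof -
        have "(inv x \<otimes> z) \<otimes> (inv z \<otimes> y) = inv x \<otimes> (z \<otimes> inv z) \<otimes> y"
          using xy z by (simp add: m_assoc del: r_inv)
        then show ?thesis using xy z by (simp add: inv_mult_group del: inv_solve_left)
      qed
      ultimately show False using U by simp
    qed
    then show "\<exists>U V. openin quotient_top U \<and> openin quotient_top V \<and> a \<in> U \<and> b \<in> V \<and> disjnt U V"
      using A B xy by blast
  qed
  show "continuous_map (prod_topology quotient_top quotient_top) quotient_top
     (\<lambda>(x, y). x \<otimes>\<^bsub>G Mod core\<^esub> y)"
    unfolding continuous_map
  proof (intro conjI allI impI)
    show "(\<lambda>(x, y). x \<otimes>\<^bsub>G Mod core\<^esub> y) ` topspace (prod_topology quotient_top quotient_top) \<subseteq> topspace quotient_top"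
      by (auto simp: proj_mult simp del: mult_FactGroup)
    fix X assume X: "openin quotient_top X"
    show "openin (prod_topology quotient_top quotient_top)
      {z \<in> topspace (prod_topology quotient_top quotient_top). (\<lambda>(x, y). x \<otimes>\<^bsub>G Mod core\<^esub> y) z \<in> X}"
      unfolding openin_prod_topology_alt
    proof (intro allI impI)
      fix c e assume "(c, e) \<in> {z \<in> topspace (prod_topology quotient_top quotient_top). (\<lambda>(x, y). x \<otimes>\<^bsub>G Mod core\<^esub> y) z \<in> X}"
      then obtain a b where ab: "a \<in> carrier G" "b \<in> carrier G" "c = proj a" "e = proj b"
        and abX: "proj (a \<otimes> b) \<in> X"
        by (auto simp: proj_mult simp del: mult_FactGroup)
      obtain U where U: "U \<in> \<Gamma>" "\<And>v. v \<in> U \<Longrightarrow> proj (a \<otimes> b \<otimes> v) \<in> X"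
        using quotient_openD[OF X _ abX] ab by auto
      obtain V where V: "V \<in> \<Gamma>" "\<And>v w. v \<in> V \<Longrightarrow> w \<in> V \<Longrightarrow> v \<otimes> w \<in> U"
        using multiply[OF U(1)] by blast
      \<comment> \<open>Moving the perturbation of \<open>a\<close> to the right past
        \<open>b\<close> conjugates it by \<open>b\<close>; this is where \<open>conjugate\<close>
        makes multiplication continuous.\<close>
      obtain W where W: "W \<in> \<Gamma>" "\<And>w. w \<in> W \<Longrightarrow> inv b \<otimes> w \<otimes> b \<in> V"
        using conjugate[OF V(1) ab(2)] by blast
      obtain A where A: "openin quotient_top A" "proj a \<in> A"
        "\<And>z. z \<in> carrier G \<Longrightarrow> proj z \<in> A \<Longrightarrow> inv a \<otimes> z \<in> W" using quotient_nbhd[OF ab(1) W(1)] by blast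
      obtain B where B: "openin quotient_top B" "proj b \<in> B"
        "\<And>z. z \<in> carrier G \<Longrightarrow> proj z \<in> B \<Longrightarrow> inv b \<otimes> z \<in> V" using quotient_nbhd[OF ab(2) V(1)] by blast
      have "proj (y \<otimes> z) \<in> X" if "y \<in> carrier G" "z \<in> carrier G" "proj y \<in> A" "proj z \<in> B" for y z
      proof -
        have "a \<otimes> b \<otimes> ((inv b \<otimes> (inv a \<otimes> y) \<otimes> b) \<otimes> (inv b \<otimes> z))
            = a \<otimes> (b \<otimes> inv b) \<otimes> inv a \<otimes> y \<otimes> (b \<otimes> inv b) \<otimes> z"
          using that ab by (simp add: m_assoc del: r_inv)
        also have "\<dots> = y \<otimes> z" using that ab by simp
        finally have eq: "a \<otimes> b \<otimes> ((inv b \<otimes> (inv a \<otimes> y) \<otimes> b) \<otimes> (inv b \<otimes> z)) = y \<otimes> z" .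
        have "proj (a \<otimes> b \<otimes> ((inv b \<otimes> (inv a \<otimes> y) \<otimes> b) \<otimes> (inv b \<otimes> z))) \<in> X"
          using that by (intro U(2) V(2) W(2) A(3) B(3))
        then show ?thesis by (simp only: eq)
      qed
      moreover have "\<exists>y\<in>carrier G. u = proj y" if "u \<in> A \<or> u \<in> B" for u
        using that openin_subset[OF A(1)] openin_subset[OF B(1)] by auto
      ultimately have "u \<otimes>\<^bsub>G Mod core\<^esub> v \<in> X" if "u \<in> A" "v \<in> B" for u v
        using that by (metis proj_mult)
      then have "A \<times> B \<subseteq> {z \<in> topspace (prod_topology quotient_top quotient_top). (\<lambda>(x, y). x \<otimes>\<^bsub>G Mod core\<^esub> y) z \<in> X}"
        using openin_subset[OF A(1)] openin_subset[OF B(1)] by (auto simp del: mult_FactGroup)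
      then show "\<exists>U V. openin quotient_top U \<and> openin quotient_top V \<and> c \<in> U \<and> e \<in> V \<and>
         U \<times> V \<subseteq> {z \<in> topspace (prod_topology quotient_top quotient_top). (\<lambda>(x, y). x \<otimes>\<^bsub>G Mod core\<^esub> y) z \<in> X}"
        using A B ab by blast
    qed
  qed
  show "continuous_map quotient_top quotient_top (\<lambda>x. inv\<^bsub>G Mod core\<^esub> x)"
    unfolding continuous_map
  proof (intro conjI allI impI)
    show "(\<lambda>x. inv\<^bsub>G Mod core\<^esub> x) ` topspace quotient_top \<subseteq> topspace quotient_top"
      by (auto simp: proj_inv)
    fix X assume X: "openin quotient_top X"
    show "openin quotient_top {x \<in> topspace quotient_top. inv\<^bsub>G Mod core\<^esub> x \<in> X}"
      unfolding openin_quotient_top quotient_open_def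
    proof (intro conjI ballI impI)
      fix a assume a: "a \<in> carrier G" "proj a \<in> {x \<in> topspace quotient_top. inv\<^bsub>G Mod core\<^esub> x \<in> X}"
      then have aX: "proj (inv a) \<in> X" by (simp add: proj_inv)
      obtain U where U: "U \<in> \<Gamma>" "\<And>v. v \<in> U \<Longrightarrow> proj (inv a \<otimes> v) \<in> X"
        using quotient_openD[OF X _ aX] a by auto
      obtain V where V: "V \<in> \<Gamma>" "\<And>v. v \<in> V \<Longrightarrow> inv (inv a) \<otimes> v \<otimes> inv a \<in> U"
        using conjugate[OF U(1), of "inv a"] a by blast
      obtain W where W: "W \<in> \<Gamma>" "\<And>v. v \<in> W \<Longrightarrow> inv v \<in> V"
        using invert[OF V(1)] by blast
      have "inv\<^bsub>G Mod core\<^esub> (proj (a \<otimes> v)) \<in> X" if "v \<in> W" for v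
      proof -
        have v: "v \<in> carrier G" using nbhd_carrier[OF W(1) that] .
        have "inv a \<otimes> (a \<otimes> inv v \<otimes> inv a) = inv (a \<otimes> v)"
          using v a by (simp add: m_assoc[symmetric] inv_mult_group)
        then show ?thesis using U(2)[OF V(2)[OF W(2)[OF that]]] a v by (simp add: proj_inv)
      qed
      then show "\<exists>V\<in>\<Gamma>. \<forall>v\<in>V. proj (a \<otimes> v) \<in> {x \<in> topspace quotient_top. inv\<^bsub>G Mod core\<^esub> x \<in> X}"
        using W(1) a(1) nbhd_carrier[OF W(1)] by (intro bexI[of _ W]) auto
    qed auto
  qed
qed

text \<open>Members of \<Gamma> need not have open images. The base at the unit therefore consists
  of one open set \<open>X V\<close> for each \<open>V\<close>, chosen with its preimage inside
  \<open>V\<close>.\<close>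

lemma metrizable_quotient:
  assumes "countable \<Gamma>"
  shows "metrizable_space quotient_top"
proof -
  interpret Q: top_group "G Mod core" quotient_top
    by (rule topological_group_imp_top_group[OF quotient_top_group])
  have "\<exists>X. openin quotient_top X \<and> proj \<one> \<in> X \<and> (\<forall>y\<in>carrier G. proj y \<in> X \<longrightarrow> y \<in> V)"
    if V: "V \<in> \<Gamma>" for V
  proof -
    obtain X where "openin quotient_top X" "proj \<one> \<in> X"
      "\<And>y. y \<in> carrier G \<Longrightarrow> proj y \<in> X \<Longrightarrow> inv \<one> \<otimes> y \<in> V"
      using quotient_nbhd[OF one_closed V] by blast
    then show ?thesis by (intro exI[of _ X]) force
  qed
  then have "\<exists>X. \<forall>V\<in>\<Gamma>. openin quotient_top (X V) \<and> proj \<one> \<in> X V \<and>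
      (\<forall>y\<in>carrier G. proj y \<in> X V \<longrightarrow> y \<in> V)"
    by (intro bchoice ballI)
  then obtain X where X: "\<And>V. V \<in> \<Gamma> \<Longrightarrow> openin quotient_top (X V)" "\<And>V. V \<in> \<Gamma> \<Longrightarrow> proj \<one> \<in> X V"
    "\<And>V y. V \<in> \<Gamma> \<Longrightarrow> y \<in> carrier G \<Longrightarrow> proj y \<in> X V \<Longrightarrow> y \<in> V" by blast
  show ?thesis
  proof (rule Q.metrizable_if_countable_base_one[of "X ` \<Gamma>"])
    show "countable (X ` \<Gamma>)" using assms by simp
    show "openin quotient_top W \<and> \<one>\<^bsub>G Mod core\<^esub> \<in> W" if "W \<in> X ` \<Gamma>" for W
      using that X unfolding proj_one[symmetric] by blast
    fix U assume U: "openin quotient_top U" "\<one>\<^bsub>G Mod core\<^esub> \<in> U"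
    then obtain V where V: "V \<in> \<Gamma>" "\<forall>v\<in>V. proj (\<one> \<otimes> v) \<in> U"
      using quotient_openD[OF U(1) one_closed] by (auto simp: proj_one simp del: one_FactGroup)
    have "X V \<subseteq> U"
    proof
      fix a assume a: "a \<in> X V"
      then obtain y where y: "y \<in> carrier G" "a = proj y" using openin_subset[OF X(1)[OF V(1)]] by auto
      then show "a \<in> U" using V X(3)[OF V(1) y(1)] a by force
    qed
    then show "\<exists>W\<in>X ` \<Gamma>. W \<subseteq> U" using V by blast
  qed
qed

text \<open>\<open>cont\<close> is continuity with respect to \<Gamma>. It already forces
  \<open>h\<close> to be constant on cosets: \<open>core\<close> lies in every \<open>V\<close>, so
  no open set contains the value at one point of a coset and misses the value at another, and
  \<open>Y\<close> is T1. The codomain is general because both a real function and a homomorphism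
  have to be factored.\<close>

lemma continuous_map_factors:
  assumes Y: "t1_space Y" and h: "h ` carrier G \<subseteq> topspace Y"
    and cont: "\<And>x A. x \<in> carrier G \<Longrightarrow> openin Y A \<Longrightarrow> h x \<in> A \<Longrightarrow> \<exists>V\<in>\<Gamma>. \<forall>v\<in>V. h (x \<otimes> v) \<in> A"
  obtains g where "continuous_map quotient_top Y g" "\<And>x. x \<in> carrier G \<Longrightarrow> g (proj x) = h x"
proof -
  have const: "h x = h y" if xy: "x \<in> carrier G" "y \<in> carrier G" "proj x = proj y" for x y
  proof (rule ccontr)
    assume "h x \<noteq> h y"
    moreover have "h x \<in> topspace Y" "h y \<in> topspace Y" using h xy by auto
    ultimately obtain A where A: "openin Y A" "h x \<in> A" "h y \<notin> A"
      using Y unfolding t1_space_def by metis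
    have "inv x \<otimes> y \<in> core" using xy proj_eq_iff by blast
    then have "h (x \<otimes> (inv x \<otimes> y)) \<in> A" using cont[OF xy(1) A(1,2)] by (auto simp: core_def)
    then show False using A(3) xy by simp
  qed
  define g where "g c = h (SOME x. x \<in> carrier G \<and> proj x = c)" for c
  have g: "g (proj x) = h x" if "x \<in> carrier G" for x
    unfolding g_def by (rule someI2[of _ x]) (use that in simp, metis const that)
  show ?thesis
  proof (rule that[of g])
    show "continuous_map quotient_top Y g"
      unfolding continuous_map
    proof (intro conjI allI impI)
      show "g ` topspace quotient_top \<subseteq> topspace Y" using g h by auto
      fix A assume A: "openin Y A"
      show "openin quotient_top {x \<in> topspace quotient_top. g x \<in> A}"
        unfolding openin_quotient_top quotient_open_def
      proof (intro conjI ballI impI)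
        fix x assume x: "x \<in> carrier G" "proj x \<in> {x \<in> topspace quotient_top. g x \<in> A}"
        then obtain V where V: "V \<in> \<Gamma>" "\<forall>v\<in>V. h (x \<otimes> v) \<in> A" using cont[OF x(1) A] g by auto
        then show "\<exists>V\<in>\<Gamma>. \<forall>v\<in>V. proj (x \<otimes> v) \<in> {x \<in> topspace quotient_top. g x \<in> A}"
          using x(1) nbhd_carrier[OF V(1)] g by (intro bexI[of _ V]) auto
      qed auto
    qed
  qed (rule g)
qed

end

subsection \<open>Perfect homomorphisms onto second countable groups\<close>

text \<open>Countably many closing steps suffice, since the stages increase and any two members
  occur at a common one. \<open>k\<close> is binary and set-valued so that intersections and
  countable families of refinements are added in the same pass.\<close>

lemma countable_closure:
  assumes I: "countable I" "I \<subseteq> N"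
    and k: "\<And>a b. a \<in> N \<Longrightarrow> b \<in> N \<Longrightarrow> countable (k a b)" "\<And>a b. a \<in> N \<Longrightarrow> b \<in> N \<Longrightarrow> k a b \<subseteq> N"
  shows "\<exists>\<Gamma>. I \<subseteq> \<Gamma> \<and> countable \<Gamma> \<and> \<Gamma> \<subseteq> N \<and> (\<forall>a\<in>\<Gamma>. \<forall>b\<in>\<Gamma>. k a b \<subseteq> \<Gamma>)"
proof -
  define F where "F A = A \<union> (\<Union>a\<in>A. \<Union>b\<in>A. k a b)" for A
  define S where "S n = (F ^^ n) I" for n
  have S0: "S 0 = I" and SSuc: "S (Suc n) = F (S n)" for n by (simp_all add: S_def)
  have S: "countable (S n) \<and> S n \<subseteq> N" for n
  proof (induction n)
    case 0
    then show ?case using I by (simp add: S0)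
  next
    case (Suc n)
    then have "countable (F (S n))"
      unfolding F_def by (intro countable_Un countable_UN) (auto intro: k(1))
    moreover have "F (S n) \<subseteq> N" unfolding F_def using Suc k(2) by blast
    ultimately show ?case by (simp add: SSuc)
  qed
  have mono: "S m \<subseteq> S n" if "m \<le> n" for m n
    using that by (induction rule: dec_induct) (auto simp: SSuc F_def)
  show ?thesis
  proof (intro exI[of _ "\<Union>n. S n"] conjI ballI)
    show "I \<subseteq> (\<Union>n. S n)" using S0 by blast
    show "countable (\<Union>n. S n)" "(\<Union>n. S n) \<subseteq> N" using S by auto
    fix a b assume "a \<in> (\<Union>n. S n)" "b \<in> (\<Union>n. S n)"
    then obtain m n where "a \<in> S m" "b \<in> S n" by blast
    then have "a \<in> S (max m n)" "b \<in> S (max m n)" using mono[of m "max m n"] mono[of n "max m n"] by auto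
    then have "k a b \<subseteq> S (Suc (max m n))" by (auto simp: SSuc F_def)
    then show "k a b \<subseteq> (\<Union>n. S n)" by blast
  qed
qed

lemma proper_map_eq:
  assumes f: "proper_map X Y f" and eq: "\<And>x. x \<in> topspace X \<Longrightarrow> f x = g x"
  shows "proper_map X Y g"
proof -
  have "{x \<in> topspace X. g x = y} = {x \<in> topspace X. f x = y}" for y using eq by auto
  moreover have "closed_map X Y g" using f eq closed_map_eq proper_imp_closed_map by blast
  ultimately show ?thesis using f by (simp add: proper_map_def)
qed

section \<open>Lindelof groups: countable control of conjugation and of continuity\<close>

context top_group
begin

text \<open>The neighbourhood \<open>V x\<close> may depend on its centre. A property that holds
  uniformly on each translate then needs only countably many centres.\<close>

lemma Lindelof_translates:
  assumes L: "Lindelof_space T" and V: "\<And>x. x \<in> carrier G \<Longrightarrow> openin T (V x) \<and> \<one> \<in> V x"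
  shows "\<exists>C. C \<subseteq> carrier G \<and> countable C \<and> (\<forall>y\<in>carrier G. \<exists>x\<in>C. inv x \<otimes> y \<in> V x)"
proof -
  define W where "W x = {y \<in> carrier G. inv x \<otimes> y \<in> V x}" for x
  have op: "openin T (W x)" if "x \<in> carrier G" for x
    unfolding W_def using V[OF that] that by (intro openin_translate) auto
  have "x \<in> W x" if "x \<in> carrier G" for x using V[OF that] that by (simp add: W_def)
  then have "\<Union>(W ` carrier G) = topspace T" by (auto simp: W_def)
  then have "\<exists>\<V>. countable \<V> \<and> \<V> \<subseteq> W ` carrier G \<and> \<Union>\<V> = topspace T"
    using op by (intro Lindelof_spaceD[OF L]) auto
  then obtain \<V> where \<V>: "countable \<V>" "\<V> \<subseteq> W ` carrier G" "\<Union>\<V> = topspace T"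
    by (elim exE conjE)
  then obtain C where C: "C \<subseteq> carrier G" "countable C" "\<V> = W ` C"
    by (meson countable_subset_image)
  show ?thesis
  proof (intro exI[of _ C] conjI C(1,2) ballI)
    fix y assume "y \<in> carrier G"
    then have "y \<in> \<Union>(W ` C)" using \<V>(3) C(3) by simp
    then show "\<exists>x\<in>C. inv x \<otimes> y \<in> V x" by (auto simp: W_def)
  qed
qed

text \<open>By joint continuity one \<open>V x\<close> conjugates into \<open>U\<close> not only
  under \<open>x\<close> but under all \<open>x \<otimes> v\<close> with \<open>v\<close> in
  \<open>V x\<close>. Countably many of these translates cover the group, so their
  \<open>V x\<close> serve every element. The last two clauses are \<open>divide\<close> and
  \<open>conjugate\<close> of \<open>nbhd_system\<close> with the witnesses confined to a countable
  family.\<close>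

lemma Lindelof_refine:
  assumes L: "Lindelof_space T" and U: "openin T U" "\<one> \<in> U"
  shows "\<exists>\<V>. countable \<V> \<and> (\<forall>V\<in>\<V>. openin T V \<and> \<one> \<in> V) \<and>
     (\<exists>V\<in>\<V>. \<forall>v\<in>V. \<forall>w\<in>V. v \<otimes> inv w \<in> U) \<and>
     (\<forall>x\<in>carrier G. \<exists>V\<in>\<V>. \<forall>v\<in>V. inv x \<otimes> v \<otimes> x \<in> U)"
proof -
  have "\<exists>V. openin T V \<and> \<one> \<in> V \<and> (\<forall>v\<in>V. \<forall>w\<in>V. inv (x \<otimes> v) \<otimes> w \<otimes> (x \<otimes> v) \<in> U)"
    if x: "x \<in> carrier G" for x
  proof -
    have "continuous_map (prod_topology T T) T (\<lambda>p. inv (x \<otimes> fst p) \<otimes> snd p \<otimes> (x \<otimes> fst p))"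
      using x by (intro continuous_map_mult continuous_map_inv continuous_map_fst continuous_map_snd
          continuous_map_const_group)
    then have "continuous_map (prod_topology T T) T (\<lambda>(v, w). inv (x \<otimes> v) \<otimes> w \<otimes> (x \<otimes> v))"
      by (simp add: case_prod_unfold)
    from nbhd2[OF this U(1)] show ?thesis using x U by (metis inv_closed l_inv m_closed one_closed r_one)
  qed
  then have "\<exists>V. \<forall>x\<in>carrier G. openin T (V x) \<and> \<one> \<in> V x \<and>
      (\<forall>v\<in>V x. \<forall>w\<in>V x. inv (x \<otimes> v) \<otimes> w \<otimes> (x \<otimes> v) \<in> U)"
    by (intro bchoice ballI)
  then obtain V where V: "\<And>x. x \<in> carrier G \<Longrightarrow> openin T (V x) \<and> \<one> \<in> V x"
    "\<And>x v w. x \<in> carrier G \<Longrightarrow> v \<in> V x \<Longrightarrow> w \<in> V x \<Longrightarrow> inv (x \<otimes> v) \<otimes> w \<otimes> (x \<otimes> v) \<in> U"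
    by blast
  have "\<exists>C. C \<subseteq> carrier G \<and> countable C \<and> (\<forall>y\<in>carrier G. \<exists>x\<in>C. inv x \<otimes> y \<in> V x)"
    using V(1) by (intro Lindelof_translates[OF L])
  then obtain C where C: "C \<subseteq> carrier G" "countable C" "\<And>y. y \<in> carrier G \<Longrightarrow> \<exists>x\<in>C. inv x \<otimes> y \<in> V x"
    by (elim exE conjE) (erule that, assumption, erule (1) bspec)
  have "continuous_map (prod_topology T T) T (\<lambda>p. fst p \<otimes> inv (snd p))"
    by (intro continuous_map_mult continuous_map_inv continuous_map_fst continuous_map_snd)
  then have "continuous_map (prod_topology T T) T (\<lambda>(v, w). v \<otimes> inv w)"
    by (simp add: case_prod_unfold)
  from nbhd2[OF this U(1)] obtain D where D: "openin T D" "\<one> \<in> D"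
    "\<And>v w. v \<in> D \<Longrightarrow> w \<in> D \<Longrightarrow> v \<otimes> inv w \<in> U" using U by auto
  show ?thesis
  proof (intro exI[of _ "insert D (V ` C)"] conjI)
    show "countable (insert D (V ` C))" using C by simp
    show "\<forall>W\<in>insert D (V ` C). openin T W \<and> \<one> \<in> W" using C(1) V(1) D by auto
    show "\<exists>W\<in>insert D (V ` C). \<forall>v\<in>W. \<forall>w\<in>W. v \<otimes> inv w \<in> U" using D(3) by (intro bexI[of _ D]) auto
    show "\<forall>x\<in>carrier G. \<exists>W\<in>insert D (V ` C). \<forall>v\<in>W. inv x \<otimes> v \<otimes> x \<in> U"
    proof
      fix y assume y: "y \<in> carrier G"
      obtain x where x: "x \<in> C" "inv x \<otimes> y \<in> V x" using C(3)[OF y] by blast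
      then have xc: "x \<in> carrier G" using C(1) by blast
      have "inv y \<otimes> w \<otimes> y \<in> U" if "w \<in> V x" for w
        using V(2)[OF xc x(2) that] xc y by simp
      then show "\<exists>W\<in>insert D (V ` C). \<forall>v\<in>W. inv y \<otimes> v \<otimes> y \<in> U"
        using x(1) by (intro bexI[of _ "V x"]) auto
    qed
  qed
qed

text \<open>The device used for conjugation, applied to \<open>f\<close> at each accuracy
  \<open>1 / Suc n\<close>: \<open>V n x\<close> controls \<open>f\<close> under two successive
  shifts, the first to reach any point of the translate and the second to perturb it.\<close>

lemma Lindelof_modulus:
  fixes f :: "'a \<Rightarrow> real"
  assumes L: "Lindelof_space T" and f: "continuous_map T euclideanreal f"
  shows "\<exists>\<V>. countable \<V> \<and> (\<forall>V\<in>\<V>. openin T V \<and> \<one> \<in> V) \<and>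
     (\<forall>x\<in>carrier G. \<forall>e>0. \<exists>V\<in>\<V>. \<forall>v\<in>V. \<bar>f (x \<otimes> v) - f x\<bar> < e)"
proof -
  have "\<exists>V. openin T V \<and> \<one> \<in> V \<and> (\<forall>v\<in>V. \<forall>w\<in>V. \<bar>f (x \<otimes> v \<otimes> w) - f x\<bar> < e)"
    if x: "x \<in> carrier G" and e: "e > 0" for x e
  proof -
    obtain U where U: "openin T U" "x \<in> U" "\<And>y. y \<in> U \<Longrightarrow> \<bar>f y - f x\<bar> < e"
      using f x e unfolding continuous_map_real_iff topspace_eq by meson
    have "continuous_map (prod_topology T T) T (\<lambda>p. x \<otimes> fst p \<otimes> snd p)"
      using x by (intro continuous_map_mult continuous_map_fst continuous_map_snd
          continuous_map_const_group)
    then have "continuous_map (prod_topology T T) T (\<lambda>(v, w). x \<otimes> v \<otimes> w)"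
      by (simp add: case_prod_unfold)
    from nbhd2[OF this U(1)] obtain V where "openin T V" "\<one> \<in> V" "\<And>v w. v \<in> V \<Longrightarrow> w \<in> V \<Longrightarrow> x \<otimes> v \<otimes> w \<in> U"
      using x U(2) by auto
    then show ?thesis using U(3) by (intro exI[of _ V]) auto
  qed
  then have "\<exists>V. \<forall>x\<in>carrier G. openin T (V x) \<and> \<one> \<in> V x \<and>
      (\<forall>v\<in>V x. \<forall>w\<in>V x. \<bar>f (x \<otimes> v \<otimes> w) - f x\<bar> < e)" if "e > 0" for e
    using that by (intro bchoice ballI)
  then have "\<exists>V. \<forall>x\<in>carrier G. openin T (V x) \<and> \<one> \<in> V x \<and>
      (\<forall>v\<in>V x. \<forall>w\<in>V x. \<bar>f (x \<otimes> v \<otimes> w) - f x\<bar> < 1 / real (Suc n))" for n by simp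
  then obtain V where V: "\<And>n x. x \<in> carrier G \<Longrightarrow> openin T (V n x) \<and> \<one> \<in> V n x"
    "\<And>n x v w. x \<in> carrier G \<Longrightarrow> v \<in> V n x \<Longrightarrow> w \<in> V n x \<Longrightarrow> \<bar>f (x \<otimes> v \<otimes> w) - f x\<bar> < 1 / real (Suc n)"
    by metis
  have "\<exists>C. C \<subseteq> carrier G \<and> countable C \<and> (\<forall>y\<in>carrier G. \<exists>x\<in>C. inv x \<otimes> y \<in> V n x)" for n
    using V(1) by (intro Lindelof_translates[OF L])
  then obtain C where C: "\<And>n. C n \<subseteq> carrier G" "\<And>n. countable (C n)"
    "\<And>n y. y \<in> carrier G \<Longrightarrow> \<exists>x\<in>C n. inv x \<otimes> y \<in> V n x" by metis
  show ?thesis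
  proof (intro exI[of _ "\<Union>n. V n ` C n"] conjI)
    show "countable (\<Union>n. V n ` C n)" using C(2) by auto
    show "\<forall>W\<in>\<Union>n. V n ` C n. openin T W \<and> \<one> \<in> W" using C(1) V(1) by blast
    show "\<forall>x\<in>carrier G. \<forall>e>0. \<exists>W\<in>\<Union>n. V n ` C n. \<forall>v\<in>W. \<bar>f (x \<otimes> v) - f x\<bar> < e"
    proof (intro ballI allI impI)
      fix y and e :: real assume y: "y \<in> carrier G" and e: "e > 0"
      \<comment> \<open>\<open>f y\<close> and \<open>f (y \<otimes> v)\<close> are each compared
        with \<open>f x\<close>, so each comparison may cost \<open>e / 2\<close>.\<close>
      obtain n where n: "1 / real (Suc n) < e / 2" using e nat_approx_posE by (metis half_gt_zero)
      obtain x where x: "x \<in> C n" "inv x \<otimes> y \<in> V n x" using C(3)[OF y] by blast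
      then have xc: "x \<in> carrier G" using C(1) by blast
      have "\<bar>f (y \<otimes> v) - f y\<bar> < e" if "v \<in> V n x" for v
      proof -
        have "\<bar>f (y \<otimes> v) - f x\<bar> < 1 / real (Suc n)" using V(2)[OF xc x(2) that] xc y by simp
        moreover have "\<bar>f y - f x\<bar> < 1 / real (Suc n)"
          using V(2)[OF xc x(2), of \<one>] V(1)[OF xc, of n] xc y by simp
        ultimately show ?thesis using n by linarith
      qed
      moreover have "V n x \<in> (\<Union>n. V n ` C n)" using x(1) by blast
      ultimately show "\<exists>W\<in>\<Union>n. V n ` C n. \<forall>v\<in>W. \<bar>f (y \<otimes> v) - f y\<bar> < e" by (intro bexI) auto
    qed
  qed
qed

text \<open>Tkachenko's argument: in a Lindelof group, countably many translates of a neighbourhood suffice,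
  so the countable family of neighbourhoods witnessing the continuity of \<open>f\<close> can be closed up to one
  defining a quotient group. Adding the preimages of a base of \<open>H\<close> keeps the quotient map perfect.\<close>

lemma PR_factorizable_if_perfect_hom:
  fixes H :: "'b monoid"
  assumes H: "topological_group H S" "second_countable S" and p: "perfect_hom G T H S p"
  shows "PR_factorizable G T"
proof (rule PR_factorizableI[OF top_group])
  fix f :: "'a \<Rightarrow> real" assume f: "continuous_map T euclideanreal f"
  interpret H: top_group H S using H(1) by (rule topological_group_imp_top_group)
  have phom: "p \<in> hom G H" and pcont: "continuous_map T S p" and pprop: "proper_map T S p"
    using p by (auto simp: perfect_hom_def perfect_map_def)
  interpret p: group_hom G H p
    using phom by (simp add: group_hom_def group_hom_axioms_def)
  have L: "Lindelof_space T"
    using Lindelof_space_proper_map_preimage[OF pprop second_countable_imp_Lindelof_space[OF H(2)]] .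
  define N where "N = {U. openin T U \<and> \<one> \<in> U}"
  have "\<forall>U\<in>N. \<exists>\<V>. countable \<V> \<and> (\<forall>V\<in>\<V>. openin T V \<and> \<one> \<in> V) \<and>
     (\<exists>V\<in>\<V>. \<forall>v\<in>V. \<forall>w\<in>V. v \<otimes> inv w \<in> U) \<and>
     (\<forall>x\<in>carrier G. \<exists>V\<in>\<V>. \<forall>v\<in>V. inv x \<otimes> v \<otimes> x \<in> U)"
    using Lindelof_refine[OF L] by (auto simp: N_def)
  then have "\<exists>c. \<forall>U\<in>N. countable (c U) \<and> (\<forall>V\<in>c U. openin T V \<and> \<one> \<in> V) \<and>
     (\<exists>V\<in>c U. \<forall>v\<in>V. \<forall>w\<in>V. v \<otimes> inv w \<in> U) \<and>
     (\<forall>x\<in>carrier G. \<exists>V\<in>c U. \<forall>v\<in>V. inv x \<otimes> v \<otimes> x \<in> U)"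
    by (rule bchoice)
  then obtain c where c0: "\<forall>U\<in>N. countable (c U) \<and> (\<forall>V\<in>c U. openin T V \<and> \<one> \<in> V) \<and>
     (\<exists>V\<in>c U. \<forall>v\<in>V. \<forall>w\<in>V. v \<otimes> inv w \<in> U) \<and>
     (\<forall>x\<in>carrier G. \<exists>V\<in>c U. \<forall>v\<in>V. inv x \<otimes> v \<otimes> x \<in> U)" ..
  have c: "countable (c U)" "c U \<subseteq> N" "\<exists>V\<in>c U. \<forall>v\<in>V. \<forall>w\<in>V. v \<otimes> inv w \<in> U"
    "\<And>x. x \<in> carrier G \<Longrightarrow> \<exists>V\<in>c U. \<forall>v\<in>V. inv x \<otimes> v \<otimes> x \<in> U"
    if "U \<in> N" for U
    using bspec[OF c0 that] by (simp_all add: N_def subset_iff)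
  obtain \<F> where \<F>0: "countable \<F> \<and> (\<forall>V\<in>\<F>. openin T V \<and> \<one> \<in> V) \<and>
     (\<forall>x\<in>carrier G. \<forall>e>0. \<exists>V\<in>\<F>. \<forall>v\<in>V. \<bar>f (x \<otimes> v) - f x\<bar> < e)"
    using Lindelof_modulus[OF L f] ..
  then have \<F>: "countable \<F>" "\<F> \<subseteq> N" by (auto simp: N_def)
  obtain \<B> where \<B>: "countable \<B>" "\<And>V. V \<in> \<B> \<Longrightarrow> openin S V"
    "\<And>U x. openin S U \<Longrightarrow> x \<in> U \<Longrightarrow> \<exists>V\<in>\<B>. x \<in> V \<and> V \<subseteq> U"
    using H(2) unfolding second_countable_def by metis
  define \<P> where "\<P> = (\<lambda>B. {x \<in> carrier G. p x \<in> B}) ` {B \<in> \<B>. \<one>\<^bsub>H\<^esub> \<in> B}"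
  have \<P>: "countable \<P>" "\<P> \<subseteq> N"
    using \<B>(1) openin_continuous_map_preimage[OF pcont \<B>(2)] by (auto simp: \<P>_def N_def)
  \<comment> \<open>Closure under \<open>U \<inter> V\<close> will give \<open>directed\<close>,
    closure under \<open>c U\<close> will give \<open>divide\<close> and \<open>conjugate\<close>.
    The initial sets are those that control \<open>f\<close> and those pulled back from
    \<open>H\<close>, together with the whole group.\<close>
  have "\<exists>\<Gamma>. insert (carrier G) (\<F> \<union> \<P>) \<subseteq> \<Gamma> \<and> countable \<Gamma> \<and> \<Gamma> \<subseteq> N \<and>
      (\<forall>U\<in>\<Gamma>. \<forall>V\<in>\<Gamma>. insert (U \<inter> V) (c U) \<subseteq> \<Gamma>)"
  proof (rule countable_closure)
    show "countable (insert (carrier G) (\<F> \<union> \<P>))" using \<F> \<P> by simp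
    show "insert (carrier G) (\<F> \<union> \<P>) \<subseteq> N"
      using \<F> \<P> openin_topspace[of T] by (simp add: N_def)
    show "countable (insert (U \<inter> V) (c U))" "insert (U \<inter> V) (c U) \<subseteq> N" if "U \<in> N" "V \<in> N" for U V
      using that c(1,2) by (auto simp: N_def)
  qed
  then obtain \<Gamma> where \<Gamma>0: "insert (carrier G) (\<F> \<union> \<P>) \<subseteq> \<Gamma> \<and> countable \<Gamma> \<and> \<Gamma> \<subseteq> N \<and>
      (\<forall>U\<in>\<Gamma>. \<forall>V\<in>\<Gamma>. insert (U \<inter> V) (c U) \<subseteq> \<Gamma>)" ..
  then have \<Gamma>: "insert (carrier G) (\<F> \<union> \<P>) \<subseteq> \<Gamma>" "countable \<Gamma>" "\<Gamma> \<subseteq> N" by simp_all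
  have \<Gamma>4: "insert (U \<inter> V) (c U) \<subseteq> \<Gamma>" if "U \<in> \<Gamma>" "V \<in> \<Gamma>" for U V
    using \<Gamma>0 that by simp
  have cG: "c U \<subseteq> \<Gamma>" if "U \<in> \<Gamma>" for U using \<Gamma>4[OF that that] by simp
  interpret Q: nbhd_system G T \<Gamma>
  proof
    show "\<Gamma> \<noteq> {}" using \<Gamma>(1) by blast
    show "openin T U" "\<one> \<in> U" if "U \<in> \<Gamma>" for U using that \<Gamma>(3) by (auto simp: N_def)
    show "\<exists>W\<in>\<Gamma>. W \<subseteq> U \<inter> V" if "U \<in> \<Gamma>" "V \<in> \<Gamma>" for U V
      using \<Gamma>4[OF that] by (intro bexI[of _ "U \<inter> V"]) auto
    show "\<exists>V\<in>\<Gamma>. \<forall>v\<in>V. \<forall>w\<in>V. v \<otimes> inv w \<in> U" if "U \<in> \<Gamma>" for U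
      using c(3)[of U] cG[OF that] \<Gamma>(3) that by (meson subsetD)
    show "\<exists>V\<in>\<Gamma>. \<forall>v\<in>V. inv x \<otimes> v \<otimes> x \<in> U" if "U \<in> \<Gamma>" "x \<in> carrier G" for U x
      using c(4)[of U x] cG[OF that(1)] \<Gamma>(3) that by (meson subsetD)
  qed
  obtain g where g: "continuous_map Q.quotient_top euclideanreal g" "\<And>x. x \<in> carrier G \<Longrightarrow> g (Q.proj x) = f x"
  proof (rule Q.continuous_map_factors[of euclideanreal f])
    fix x and A :: "real set" assume x: "x \<in> carrier G" and A: "openin euclideanreal A" "f x \<in> A"
    then obtain e where e: "e > 0" "\<And>y. \<bar>y - f x\<bar> < e \<Longrightarrow> y \<in> A"
      by (auto simp: open_dist dist_real_def)
    obtain V where "V \<in> \<F>" "\<forall>v\<in>V. \<bar>f (x \<otimes> v) - f x\<bar> < e"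
      using \<F>0 x e(1) by blast
    then show "\<exists>V\<in>\<Gamma>. \<forall>v\<in>V. f (x \<otimes> v) \<in> A" using \<Gamma>(1) e(2) by (intro bexI[of _ V]) auto
  qed (auto intro: Hausdorff_imp_t1_space)
  obtain r where r: "continuous_map Q.quotient_top S r" "\<And>x. x \<in> carrier G \<Longrightarrow> r (Q.proj x) = p x"
  proof (rule Q.continuous_map_factors[of S p])
    show "t1_space S" using H.Hausdorff by (rule Hausdorff_imp_t1_space)
    show "p ` carrier G \<subseteq> topspace S" by auto
    fix x A assume x: "x \<in> carrier G" and A: "openin S A" "p x \<in> A"
    obtain V where V: "openin S V" "\<one>\<^bsub>H\<^esub> \<in> V" "\<And>v. v \<in> V \<Longrightarrow> p x \<otimes>\<^bsub>H\<^esub> v \<in> A"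
      using H.openin_nbhd[OF A] by blast
    obtain B where B: "B \<in> \<B>" "\<one>\<^bsub>H\<^esub> \<in> B" "B \<subseteq> V" using \<B>(3)[OF V(1,2)] by blast
    have "{x \<in> carrier G. p x \<in> B} \<in> \<Gamma>" using B \<Gamma>(1) by (auto simp: \<P>_def)
    moreover have "p (x \<otimes> v) \<in> A" if "v \<in> carrier G" "p v \<in> B" for v
      using V(3)[of "p v"] that B(3) x by auto
    ultimately show "\<exists>V\<in>\<Gamma>. \<forall>v\<in>V. p (x \<otimes> v) \<in> A" by (intro bexI) auto
  qed blast
  have top: "topological_group (G Mod Q.core) Q.quotient_top" by (rule Q.quotient_top_group)
  \<comment> \<open>Here the pulled-back base pays off: \<open>p\<close> is \<open>r\<close> after
    \<open>Q.proj\<close>, and since the quotient is Hausdorff, properness of the composite passes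
    to the map applied first.\<close>
  have "proper_map T S (r \<circ> Q.proj)"
    using r(2) by (intro proper_map_eq[OF pprop]) simp
  then have "proper_map T Q.quotient_top Q.proj"
    using proper_map_from_composition_right[of Q.quotient_top T S r Q.proj] top Q.continuous_proj r(1)
    by (simp add: topological_group_def)
  then have "perfect_hom G T (G Mod Q.core) Q.quotient_top Q.proj"
    using Q.proj_hom Q.continuous_proj by (simp add: perfect_hom_def perfect_map_def)
  moreover have "second_countable Q.quotient_top"
  proof (rule metrizable_Lindelof_imp_second_countable)
    show "metrizable_space Q.quotient_top" using \<Gamma>(2) by (rule Q.metrizable_quotient)
    show "Lindelof_space Q.quotient_top"
      using Lindelof_space_perfect_map_image[OF L] calculation unfolding perfect_hom_def by blast
  qed
  ultimately show "\<exists>(H :: 'a set monoid) S p g.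
           topological_group H S \<and> second_countable S \<and> perfect_hom G T H S p \<and>
           continuous_map S euclideanreal g \<and> (\<forall>x\<in>carrier G. f x = g (p x))"
    using top g by (intro exI[of _ "G Mod Q.core"] exI[of _ Q.quotient_top] exI[of _ Q.proj] exI[of _ g]) auto
qed

end

subsection \<open>The dichotomy for PM-factorizable groups\<close>

lemma continuous_map_real_local:
  fixes f :: "'a \<Rightarrow> real"
  assumes "\<And>x. x \<in> topspace X \<Longrightarrow>
     \<exists>U c. openin X U \<and> x \<in> U \<and> continuous_map X euclideanreal c \<and> (\<forall>y\<in>U. f y = c y)"
  shows "continuous_map X euclideanreal f"
  unfolding continuous_map_real_iff
proof (intro ballI allI impI)
  fix x and e :: real assume x: "x \<in> topspace X" and e: "e > 0"
  obtain U c where U: "openin X U" "x \<in> U" "continuous_map X euclideanreal c" "\<And>y. y \<in> U \<Longrightarrow> f y = c y"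
    using assms[OF x] by metis
  obtain V where V: "openin X V" "x \<in> V" "\<And>y. y \<in> V \<Longrightarrow> \<bar>c y - c x\<bar> < e"
    using U(3) x e unfolding continuous_map_real_iff by metis
  have "\<bar>f y - f x\<bar> < e" if "y \<in> U \<inter> V" for y using that U V by auto
  then show "\<exists>U. openin X U \<and> x \<in> U \<and> (\<forall>y\<in>U. \<bar>f y - f x\<bar> < e)"
    using U V by (intro exI[of _ "U \<inter> V"]) auto
qed

lemma (in Metric_space) continuous_mdist_left:
  assumes p: "continuous_map X mtopology p" and a: "a \<in> M"
  shows "continuous_map X euclideanreal (\<lambda>x. d a (p x))"
  unfolding continuous_map_real_iff
proof (intro ballI allI impI)
  fix x and e :: real assume x: "x \<in> topspace X" and e: "e > 0"
  obtain U where U: "openin X U" "x \<in> U" "\<And>y. y \<in> U \<Longrightarrow> p y \<in> mball (p x) e"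
    using p x e unfolding continuous_map_to_metric by metis
  have "\<bar>d a (p y) - d a (p x)\<bar> < e" if "y \<in> U" for y
    using U(3)[OF that] triangle[of a "p x" "p y"] triangle[of a "p y" "p x"] a
    by (auto simp: commute)
  then show "\<exists>U. openin X U \<and> x \<in> U \<and> (\<forall>y\<in>U. \<bar>d a (p y) - d a (p x)\<bar> < e)"
    using U by blast
qed

text \<open>Bumps about the points of \<open>D\<close> have supports so far apart that near any
  point at most one is active, so the glued function is locally a single \<open>b a\<close> or zero.
  Values are prescribed only over \<open>D\<close> itself, where the bump is 1.\<close>

lemma (in Metric_space) glue_along_separated:
  assumes p: "continuous_map X mtopology p"
    and D: "D \<subseteq> M" "e > 0" "\<And>a b. a \<in> D \<Longrightarrow> b \<in> D \<Longrightarrow> a \<noteq> b \<Longrightarrow> e \<le> d a b"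
    and c: "\<And>a. a \<in> D \<Longrightarrow> continuous_map X euclideanreal (c a)"
  shows "\<exists>f. continuous_map X euclideanreal f \<and> (\<forall>x\<in>topspace X. p x \<in> D \<longrightarrow> f x = c (p x) x)"
proof -
  \<comment> \<open>The factor is 1 over \<open>a\<close> and vanishes from distance
    \<open>e / 4\<close> on. If a ball of radius \<open>e / 4\<close> meets the support about
    \<open>a\<close>, its centre is within \<open>e / 2\<close> of \<open>a\<close>, and by
    separation this holds for one \<open>a\<close> only.\<close>
  define b where "b a x = max 0 (1 - 4 / e * d a (p x)) * c a x" for a x
  have b: "continuous_map X euclideanreal (b a)" if "a \<in> D" for a
    unfolding b_def using that D(1) c[OF that] continuous_mdist_left[OF p, of a]
    by (intro continuous_map_real_mult continuous_map_real_max continuous_map_diff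
        continuous_map_real_mult_left) auto
  have b0: "b a x = 0" if "e / 4 \<le> d a (p x)" for a x
    using that D(2) by (simp add: b_def max_def field_simps)
  have uniq: "a = a'" if "a \<in> D" "a' \<in> D" "z \<in> M" "d a z < e / 2" "d a' z < e / 2" for a a' z
  proof (rule ccontr)
    assume "a \<noteq> a'"
    then have "e \<le> d a a'" using D(3) that by blast
    moreover have "d a a' \<le> d a z + d z a'" using D(1) that by (intro triangle) auto
    ultimately show False using that commute[of z a'] by linarith
  qed
  \<comment> \<open>By \<open>uniq\<close> the choice is unambiguous; 0 is the common value of all
    bumps elsewhere, so the two cases fit together.\<close>
  define f where "f x = (if \<exists>a\<in>D. d a (p x) < e / 4 then b (SOME a. a \<in> D \<and> d a (p x) < e / 4) x else 0)" for x
  have pM: "p x \<in> M" if "x \<in> topspace X" for x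
    using p that continuous_map_image_subset_topspace by fastforce
  have f1: "f x = b a x" if "a \<in> D" "d a (p x) < e / 4" "x \<in> topspace X" for a x
  proof -
    have "(SOME a. a \<in> D \<and> d a (p x) < e / 4) = a"
    proof (rule some_equality)
      show "a' = a" if "a' \<in> D \<and> d a' (p x) < e / 4" for a'
        using uniq[of a' a "p x"] that \<open>a \<in> D\<close> \<open>d a (p x) < e / 4\<close> pM[OF \<open>x \<in> topspace X\<close>] D(2) by auto
    qed (use that in simp)
    then show ?thesis using that unfolding f_def by auto
  qed
  have f0: "f x = 0" if "\<And>a. a \<in> D \<Longrightarrow> e / 4 \<le> d a (p x)" for x
    using that unfolding f_def by (auto simp: not_less[symmetric])
  show ?thesis
  proof (intro exI[of _ f] conjI ballI impI)
    show "continuous_map X euclideanreal f"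
    proof (rule continuous_map_real_local)
      fix x assume x: "x \<in> topspace X"
      define U where "U = {y \<in> topspace X. p y \<in> mball (p x) (e / 4)}"
      have "openin X U" unfolding U_def by (rule openin_continuous_map_preimage[OF p openin_mball])
      moreover have "x \<in> U" using x D(2) pM[OF x] by (simp add: U_def)
      moreover have "\<exists>c. continuous_map X euclideanreal c \<and> (\<forall>y\<in>U. f y = c y)"
      proof (cases "\<exists>a\<in>D. d a (p x) < e / 2")
        case True
        then obtain a where a: "a \<in> D" "d a (p x) < e / 2" by blast
        have "f y = b a y" if y: "y \<in> U" for y
        proof (cases "\<exists>a'\<in>D. d a' (p y) < e / 4")
          case True
          then obtain a' where a': "a' \<in> D" "d a' (p y) < e / 4" by blast
          have "d a' (p x) \<le> d a' (p y) + d (p y) (p x)"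
            using triangle[of a' "p y" "p x"] a' y D(1) pM x by (auto simp: U_def)
          then have "d a' (p x) < e / 2" using a' y by (auto simp: U_def commute)
          then have "a' = a" using uniq[OF a'(1) a(1) pM[OF x]] a by blast
          then show ?thesis using f1[OF a'] y by (simp add: U_def)
        next
          case False
          then have "e / 4 \<le> d a' (p y)" if "a' \<in> D" for a' using that by (auto simp: not_less)
          then show ?thesis using f0[of y] b0[of a y] a(1) by simp
        qed
        then show ?thesis using b[OF a(1)] by blast
      next
        case False
        have "f y = 0" if y: "y \<in> U" for y
        proof (rule f0)
          fix a assume a: "a \<in> D"
          have "d a (p x) \<le> d a (p y) + d (p y) (p x)"
            using triangle[of a "p y" "p x"] a y D(1) pM x by (auto simp: U_def)
          moreover have "e / 2 \<le> d a (p x)" using False a by (auto simp: not_less)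
          moreover have "d (p y) (p x) < e / 4" using y by (auto simp: U_def commute)
          ultimately show "e / 4 \<le> d a (p y)" by linarith
        qed
        then show ?thesis by (intro exI[of _ "\<lambda>_. 0"]) auto
      qed
      ultimately show "\<exists>U c. openin X U \<and> x \<in> U \<and> continuous_map X euclideanreal c \<and> (\<forall>y\<in>U. f y = c y)"
        by blast
    qed
    fix x assume x: "x \<in> topspace X" "p x \<in> D"
    have "d (p x) (p x) = 0" using pM[OF x(1)] by simp
    then show "f x = c (p x) x" using f1[of "p x" x] x D(2) by (simp add: b_def)
  qed
qed

text \<open>A maximal \<open>e\<close>-separated set is an \<open>e\<close>-net, so at a radius that
  admits no countable net it is uncountable.\<close>

lemma (in Metric_space) uncountable_separated:
  assumes "\<not> second_countable mtopology"
  obtains e D where "e > 0" "D \<subseteq> M" "uncountable D" "\<And>a b. a \<in> D \<Longrightarrow> b \<in> D \<Longrightarrow> a \<noteq> b \<Longrightarrow> e \<le> d a b"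
proof -
  obtain e where e: "e > 0" and no: "\<And>C. countable C \<Longrightarrow> C \<subseteq> M \<Longrightarrow> \<exists>x\<in>M. \<forall>c\<in>C. e \<le> d c x"
    using assms second_countable_if_nets by (meson not_le)
  obtain D where D: "D \<subseteq> M" "pairwise (\<lambda>a b. e \<le> d a b) D" "\<And>x. x \<in> M \<Longrightarrow> x \<notin> D \<Longrightarrow> \<exists>s\<in>D. \<not> e \<le> d s x"
    by (rule maximal_separated[of "\<lambda>a b. e \<le> d a b" M]) (auto simp: commute)
  have "uncountable D"
  proof
    assume "countable D"
    from no[OF this D(1)] obtain x where x: "x \<in> M" "\<forall>c\<in>D. e \<le> d c x" ..
    have "x \<notin> D" using x e by force
    then show False using D(3)[OF x(1)] x(2) by blast
  qed
  then show ?thesis using that[OF e D(1)] D(2) by (simp add: pairwise_def)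
qed

text \<open>Of two sets one injects into the other, so either \<open>A\<close> itself or an image of
  \<open>B\<close> inside \<open>A\<close> will do. This attaches distinct functions to uncountably
  many separated points although the two cardinals are unrelated.\<close>

lemma uncountable_injection:
  assumes A: "uncountable A" and B: "uncountable B"
  obtains A' h where "A' \<subseteq> A" "uncountable A'" "inj_on h A'" "h ` A' \<subseteq> B"
proof -
  have "(card_of A, card_of B) \<in> ordLeq \<or> (card_of B, card_of A) \<in> ordLeq"
    by (rule ordLeq_total) (rule card_of_Well_order)+
  then consider f where "inj_on f A" "f ` A \<subseteq> B" | f where "inj_on f B" "f ` B \<subseteq> A"
    unfolding card_of_ordLeq[symmetric] by blast
  then show ?thesis
  proof cases
    case 1
    then show ?thesis using that[of A] A by blast
  next
    case (2 f)
    have "uncountable (f ` B)" using B 2(1) countable_image_inj_on by blast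
    then show ?thesis using that[of "f ` B" "inv_into B f"] 2 by (simp add: inj_on_inv_into image_subset_iff)
  qed
qed

text \<open>Up to an error of 1/8, a function is determined by finitely
  many pairs of a basic open set and a rational value.\<close>

lemma countable_separated_functions:
  fixes g :: "'d \<Rightarrow> 'z \<Rightarrow> real"
  assumes Z: "compact_space Z" "second_countable Z"
    and cont: "\<And>a. a \<in> D \<Longrightarrow> continuous_map Z euclideanreal (g a)"
    and sep: "\<And>a b. a \<in> D \<Longrightarrow> b \<in> D \<Longrightarrow> a \<noteq> b \<Longrightarrow> \<exists>z\<in>topspace Z. 1/4 \<le> \<bar>g a z - g b z\<bar>"
  shows "countable D"
proof -
  obtain \<B> where \<B>: "countable \<B>" "\<And>V. V \<in> \<B> \<Longrightarrow> openin Z V"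
    "\<And>U x. openin Z U \<Longrightarrow> x \<in> U \<Longrightarrow> \<exists>V\<in>\<B>. x \<in> V \<and> V \<subseteq> U"
    using Z(2) unfolding second_countable_def by metis
  define P where "P a L \<longleftrightarrow> topspace Z \<subseteq> \<Union>(fst ` L) \<and> (\<forall>(V, q)\<in>L. \<forall>y\<in>V. \<bar>g a y - q\<bar> < 1/8)" for a and L :: "('z set \<times> real) set"
  have "\<exists>L. finite L \<and> L \<subseteq> \<B> \<times> \<rat> \<and> P a L" if a: "a \<in> D" for a
  proof -
    define \<L> where "\<L> = {(V, q). V \<in> \<B> \<and> q \<in> \<rat> \<and> (\<forall>y\<in>V. \<bar>g a y - q\<bar> < 1/8)}"
    have cover: "topspace Z \<subseteq> \<Union>(fst ` \<L>)"
    proof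
      fix z assume z: "z \<in> topspace Z"
      \<comment> \<open>An error of 1/16 for the rational and 1/16 for the oscillation of
        \<open>g a\<close> on \<open>U\<close> add up to the tolerance 1/8 in
        \<open>P\<close>.\<close>
      obtain q where q: "q \<in> \<rat>" "g a z - 1/16 < q" "q < g a z"
        using Rats_dense_in_real[of "g a z - 1/16" "g a z"] by auto
      obtain U where U: "openin Z U" "z \<in> U" "\<And>y. y \<in> U \<Longrightarrow> \<bar>g a y - g a z\<bar> < 1/16"
        using cont[OF a] z unfolding continuous_map_real_iff by (metis divide_pos_pos zero_less_numeral zero_less_one)
      obtain V where V: "V \<in> \<B>" "z \<in> V" "V \<subseteq> U" using \<B>(3)[OF U(1,2)] by blast
      have "\<bar>g a y - q\<bar> < 1/8" if "y \<in> V" for y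
        using U(3)[of y] V(3) that q by (auto simp: abs_if split: if_splits)
      then have "(V, q) \<in> \<L>" using V q by (simp add: \<L>_def)
      then show "z \<in> \<Union>(fst ` \<L>)" using V(2) by force
    qed
    have "\<forall>U\<in>fst ` \<L>. openin Z U" using \<B>(2) by (auto simp: \<L>_def)
    then obtain \<F> where \<F>: "finite \<F>" "\<F> \<subseteq> fst ` \<L>" "topspace Z \<subseteq> \<Union>\<F>"
      using Z(1) cover unfolding compact_space_alt by meson
    obtain L where "L \<subseteq> \<L>" "finite L" "\<F> = fst ` L"
      using finite_subset_image[OF \<F>(1,2)] by blast
    then have "finite L" "L \<subseteq> \<L>" "topspace Z \<subseteq> \<Union>(fst ` L)" using \<F>(3) by auto
    then show ?thesis by (intro exI[of _ L]) (auto simp: P_def \<L>_def)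
  qed
  then obtain L where L: "\<And>a. a \<in> D \<Longrightarrow> finite (L a) \<and> L a \<subseteq> \<B> \<times> \<rat> \<and> P a (L a)" by metis
  have "inj_on L D"
  proof (rule inj_onI, rule ccontr)
    fix a b assume ab: "a \<in> D" "b \<in> D" "L a = L b" "a \<noteq> b"
    then obtain z where z: "z \<in> topspace Z" "1/4 \<le> \<bar>g a z - g b z\<bar>" using sep by blast
    have "z \<in> \<Union>(fst ` L a)" using L[OF ab(1)] z(1) by (auto simp: P_def)
    then obtain V q where V: "(V, q) \<in> L a" "z \<in> V" by auto
    have "\<bar>g a z - q\<bar> < 1/8" using L[OF ab(1)] V by (auto simp: P_def)
    moreover have "\<bar>g b z - q\<bar> < 1/8" using L[OF ab(2)] V ab(3) by (auto simp: P_def)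
    ultimately show False using z(2) by linarith
  qed
  moreover have fin: "countable {F. finite F \<and> F \<subseteq> \<B> \<times> \<rat>}"
    using \<B>(1) countable_rat by (intro countable_Collect_finite_subset) auto
  have "countable (L ` D)" by (rule countable_subset[OF _ fin]) (use L in auto)
  ultimately show ?thesis using countable_image_inj_on by blast
qed

section \<open>Metrizability from countably many functions, and the dichotomy\<close>

context top_group
begin

text \<open>Two controls combine to a base at the unit: \<open>p x\<close> close to the unit of
  \<open>H\<close> brings \<open>x\<close> close to the kernel, and \<open>g x\<close> close to
  \<open>g \<one>\<close> for a suitable \<open>g\<close> localizes \<open>x\<close> along the
  kernel. Closedness of \<open>p\<close>, in the form \<open>tube\<close>, passes from the kernel to
  a neighbourhood of it.\<close>

lemma metrizable_if_perfect_hom: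
  fixes H :: "'b monoid" and \<F> :: "('a \<Rightarrow> real) set"
  assumes H: "topological_group H S" "metrizable_space S" and p: "perfect_hom G T H S p"
    and \<F>: "countable \<F>" "\<And>g. g \<in> \<F> \<Longrightarrow> continuous_map T euclideanreal g"
    and dense: "\<And>f. continuous_map T euclideanreal f \<Longrightarrow>
      \<exists>g\<in>\<F>. \<forall>x\<in>carrier G. p x = \<one>\<^bsub>H\<^esub> \<longrightarrow> \<bar>f x - g x\<bar> < 1/4"
  shows "metrizable_space T"
proof -
  interpret H: top_group H S using H(1) by (rule topological_group_imp_top_group)
  have phom: "p \<in> hom G H" and pcont: "continuous_map T S p" and pclosed: "closed_map T S p"
    using p by (auto simp: perfect_hom_def perfect_map_def proper_map_def)
  interpret p: group_hom G H p
    using phom by (simp add: group_hom_def group_hom_axioms_def)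
  have tube: "\<exists>V. openin S V \<and> \<one>\<^bsub>H\<^esub> \<in> V \<and> {x \<in> topspace T. p x \<in> V} \<subseteq> U"
    if "openin T U" "{x \<in> topspace T. p x = \<one>\<^bsub>H\<^esub>} \<subseteq> U" for U
    using pclosed that unfolding closed_map_fibre_neighbourhood by simp
  obtain \<B> where \<B>: "countable \<B>" "\<And>V. V \<in> \<B> \<Longrightarrow> openin S V"
    "\<And>U. openin S U \<Longrightarrow> \<one>\<^bsub>H\<^esub> \<in> U \<Longrightarrow> \<exists>V\<in>\<B>. \<one>\<^bsub>H\<^esub> \<in> V \<and> V \<subseteq> U"
    using metrizable_imp_first_countable[OF H(2)] unfolding first_countable_def
    by (metis H.one_closed H.topspace_eq)
  define W where "W g B = {x \<in> carrier G. g x \<in> {g \<one> - 1/3<..<g \<one> + 1/3}} \<inter> {x \<in> carrier G. p x \<in> B}" for g :: "'a \<Rightarrow> real" and B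
  show ?thesis
  proof (rule metrizable_if_countable_base_one[of "(\<lambda>(g, B). W g B) ` (\<F> \<times> {B \<in> \<B>. \<one>\<^bsub>H\<^esub> \<in> B})"])
    show "countable ((\<lambda>(g, B). W g B) ` (\<F> \<times> {B \<in> \<B>. \<one>\<^bsub>H\<^esub> \<in> B}))" using \<F>(1) \<B>(1) by simp
    have "openin T (W g B)" if "g \<in> \<F>" "B \<in> \<B>" for g B
      using openin_continuous_map_preimage[OF \<F>(2)[OF that(1)], of "{g \<one> - 1/3<..<g \<one> + 1/3}"]
        openin_continuous_map_preimage[OF pcont \<B>(2)[OF that(2)]]
      unfolding W_def by (intro openin_Int) auto
    then show "openin T V \<and> \<one> \<in> V" if "V \<in> (\<lambda>(g, B). W g B) ` (\<F> \<times> {B \<in> \<B>. \<one>\<^bsub>H\<^esub> \<in> B})" for V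
      using that by (auto simp: W_def)
    fix U assume U: "openin T U" "\<one> \<in> U"
    obtain f where f: "continuous_map T euclideanreal f" "f \<one> = 0" "\<And>x. x \<in> carrier G \<Longrightarrow> x \<notin> U \<Longrightarrow> 1 \<le> f x"
      using ex_continuous_separating[OF U] by blast
    obtain g where g: "g \<in> \<F>" "\<And>x. x \<in> carrier G \<Longrightarrow> p x = \<one>\<^bsub>H\<^esub> \<Longrightarrow> \<bar>f x - g x\<bar> < 1/4"
      using dense[OF f(1)] by blast
    \<comment> \<open>On the kernel outside \<open>U\<close>, \<open>f\<close> is at least 1 while
      \<open>f \<one> = 0\<close>; two errors below 1/4 keep \<open>g\<close> more than 1/2, hence
      more than 1/3, away from \<open>g \<one>\<close>. So \<open>O'\<close> contains the kernel,
      and the window of radius 1/3 in \<open>W\<close> cuts \<open>O'\<close> down to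
      \<open>U\<close>.\<close>
    define O' where "O' = U \<union> {x \<in> carrier G. g x \<in> - {g \<one> - 1/3..g \<one> + 1/3}}"
    have "openin T O'"
      using openin_continuous_map_preimage[OF \<F>(2)[OF g(1)], of "- {g \<one> - 1/3..g \<one> + 1/3}"] U(1)
      unfolding O'_def by (intro openin_Un) (auto simp: open_Compl)
    moreover have "{x \<in> topspace T. p x = \<one>\<^bsub>H\<^esub>} \<subseteq> O'"
    proof clarsimp
      fix x assume x: "x \<in> carrier G" "p x = \<one>\<^bsub>H\<^esub>"
      have "\<bar>f x - g x\<bar> < 1/4" "\<bar>f \<one> - g \<one>\<bar> < 1/4" using g(2) x by auto
      then show "x \<in> O'" using f(2) f(3)[OF x(1)] x(1) by (auto simp: O'_def abs_if split: if_splits)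
    qed
    ultimately have "\<exists>V. openin S V \<and> \<one>\<^bsub>H\<^esub> \<in> V \<and> {x \<in> topspace T. p x \<in> V} \<subseteq> O'"
      using tube by simp
    then obtain V where V: "openin S V" "\<one>\<^bsub>H\<^esub> \<in> V" "{x \<in> topspace T. p x \<in> V} \<subseteq> O'"
      by (elim exE conjE)
    obtain B where B: "B \<in> \<B>" "\<one>\<^bsub>H\<^esub> \<in> B" "B \<subseteq> V" using \<B>(3)[OF V(1,2)] by blast
    have "W g B \<subseteq> U" using V(3) B(3) by (auto simp: W_def O'_def)
    then show "\<exists>V\<in>(\<lambda>(g, B). W g B) ` (\<F> \<times> {B \<in> \<B>. \<one>\<^bsub>H\<^esub> \<in> B}). V \<subseteq> U" using g(1) B by blast
  qed
qed

lemma PM_factorizable_imp_metrizable_or_PR: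
  assumes PM: "PM_factorizable G T"
  shows "metrizable_space T \<or> PR_factorizable G T"
proof -
  \<comment> \<open>A constant function is factored merely to obtain some perfect homomorphism onto
    a metrizable group.\<close>
  have "continuous_map T euclideanreal (\<lambda>_. 0 :: real)" by simp
  then obtain H :: "'a monoid" and S p where H: "topological_group H S" "metrizable_space S"
    and p: "perfect_hom G T H S p"
    using PM unfolding PM_factorizable_def by meson
  interpret H: top_group H S using H(1) by (rule topological_group_imp_top_group)
  have phom: "p \<in> hom G H" and pcont: "continuous_map T S p" and psurj: "p ` carrier G = carrier H"
    and pprop: "proper_map T S p"
    using p by (auto simp: perfect_hom_def perfect_map_def)
  interpret p: group_hom G H p
    using phom by (simp add: group_hom_def group_hom_axioms_def)
  define K where "K = {x \<in> carrier G. p x = \<one>\<^bsub>H\<^esub>}"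
  have K: "compactin T K" using pprop by (auto simp: proper_map_def K_def)
  \<comment> \<open>The bound 1/4 is shared by the density hypothesis of
    \<open>metrizable_if_perfect_hom\<close> and the separation hypothesis of
    \<open>countable_separated_functions\<close>, so one maximal family serves both.\<close>
  define R where "R f g \<longleftrightarrow> (\<exists>x\<in>K. 1/4 \<le> \<bar>f x - g x\<bar>)" for f g :: "'a \<Rightarrow> real"
  obtain \<F> where \<F>: "\<F> \<subseteq> {f. continuous_map T euclideanreal f}" "pairwise R \<F>"
    "\<And>f. f \<in> {f. continuous_map T euclideanreal f} \<Longrightarrow> f \<notin> \<F> \<Longrightarrow> \<exists>g\<in>\<F>. \<not> R g f"
    by (rule maximal_separated[of R]) (auto simp: R_def abs_minus_commute)
  show ?thesis
  proof (cases "metrizable_space T")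
    case not_metrizable: False
    have "uncountable \<F>"
    proof
      assume "countable \<F>"
      then have "metrizable_space T"
      proof (rule metrizable_if_perfect_hom[OF H p])
        show "continuous_map T euclideanreal g" if "g \<in> \<F>" for g using \<F>(1) that by blast
        fix f :: "'a \<Rightarrow> real" assume f: "continuous_map T euclideanreal f"
        have "\<exists>g\<in>\<F>. \<not> R g f"
        proof (cases "f \<in> \<F>")
          case True
          then show ?thesis by (intro bexI[of _ f]) (auto simp: R_def)
        next
          case False
          then show ?thesis using \<F>(3) f by blast
        qed
        then obtain g where g: "g \<in> \<F>" "\<not> R g f" ..
        have "\<bar>f x - g x\<bar> < 1/4" if "x \<in> carrier G" "p x = \<one>\<^bsub>H\<^esub>" for x
        proof -
          have "x \<in> K" using that by (simp add: K_def)
          then have "\<bar>g x - f x\<bar> < 1/4" using g(2) unfolding R_def by (meson not_le)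
          then show ?thesis by (simp add: abs_minus_commute)
        qed
        then show "\<exists>g\<in>\<F>. \<forall>x\<in>carrier G. p x = \<one>\<^bsub>H\<^esub> \<longrightarrow> \<bar>f x - g x\<bar> < 1/4"
          using g(1) by (intro bexI[of _ g]) auto
      qed
      then show False using not_metrizable by simp
    qed
    have "second_countable S"
    proof (rule ccontr)
      assume "\<not> second_countable S"
      obtain M d where "Metric_space M d" and S: "S = Metric_space.mtopology M d"
        using H(2) by (auto simp: metrizable_space_def)
      then interpret M: Metric_space M d by simp
      obtain e D where D: "e > 0" "D \<subseteq> M" "uncountable D" "\<And>a b. a \<in> D \<Longrightarrow> b \<in> D \<Longrightarrow> a \<noteq> b \<Longrightarrow> e \<le> d a b"
        using M.uncountable_separated \<open>\<not> second_countable S\<close> unfolding S by blast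
      obtain D' h where D': "D' \<subseteq> D" "uncountable D'" "inj_on h D'" "h ` D' \<subseteq> \<F>"
        using uncountable_injection[OF D(3) \<open>uncountable \<F>\<close>] by blast
      have M: "M = carrier H" using H.topspace_eq S by simp
      \<comment> \<open>An arbitrary section, in general not continuous: it only fixes, for each
        \<open>a\<close>, a translation that carries \<open>K\<close> onto the fibre over
        \<open>a\<close>.\<close>
      define s where "s = inv_into (carrier G) p"
      have s: "s a \<in> carrier G" "p (s a) = a" if "a \<in> D'" for a
        using that D'(1) D(2) M psurj by (auto simp: s_def inv_into_into f_inv_into_f)
      \<comment> \<open>On the fibre over \<open>a\<close> the glued function is \<open>h a\<close>
        transported from \<open>K\<close> by that translation. The transported function is
        continuous on all of \<open>G\<close>, as the gluing demands.\<close>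
      have "\<exists>f. continuous_map T euclideanreal f \<and>
          (\<forall>x\<in>topspace T. p x \<in> D' \<longrightarrow> f x = h (p x) (inv (s (p x)) \<otimes> x))"
      proof (rule M.glue_along_separated[where e = e and c = "\<lambda>a x. h a (inv (s a) \<otimes> x)"])
        show "continuous_map T M.mtopology p" using pcont S by simp
        show "D' \<subseteq> M" "e > 0" using D D' by auto
        show "e \<le> d a b" if "a \<in> D'" "b \<in> D'" "a \<noteq> b" for a b using D(4) D'(1) that by blast
        show "continuous_map T euclideanreal (\<lambda>x. h a (inv (s a) \<otimes> x))" if a: "a \<in> D'" for a
        proof -
          have "continuous_map T T (\<lambda>x. inv (s a) \<otimes> x)"
            using s(1)[OF a] by (intro continuous_map_mult continuous_map_const_group) auto
          moreover have "continuous_map T euclideanreal (h a)" using D'(4) \<F>(1) a by blast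
          ultimately show ?thesis by (rule continuous_map_compose[unfolded o_def])
        qed
      qed
      then obtain f where f: "continuous_map T euclideanreal f"
        "\<And>x. x \<in> carrier G \<Longrightarrow> p x \<in> D' \<Longrightarrow> f x = h (p x) (inv (s (p x)) \<otimes> x)" by auto
      obtain H' :: "'a monoid" and S' q g where H': "topological_group H' S'" "metrizable_space S'"
        and q: "perfect_hom G T H' S' q" and g: "continuous_map S' euclideanreal g"
        and fg: "\<And>x. x \<in> carrier G \<Longrightarrow> f x = g (q x)"
        using PM f(1) unfolding PM_factorizable_def by metis
      interpret H': top_group H' S' using H'(1) by (rule topological_group_imp_top_group)
      have qhom: "q \<in> hom G H'" and qcont: "continuous_map T S' q"
        using q by (auto simp: perfect_hom_def perfect_map_def)
      interpret q: group_hom G H' q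
        using qhom by (simp add: group_hom_def group_hom_axioms_def)
      define Z where "Z = subtopology S' (q ` K)"
      have K_carrier: "K \<subseteq> carrier G" by (auto simp: K_def)
      have topZ: "topspace Z = q ` K" unfolding Z_def using K_carrier by auto
      \<comment> \<open>Since \<open>q\<close> is a homomorphism, passing to another fibre is a left
        translation in \<open>H'\<close>. Thus every \<open>h a\<close> on \<open>K\<close> is a
        continuous function of \<open>q x\<close>, with the same \<open>q\<close> for all
        \<open>a\<close>.\<close>
      have key: "g (q (s a) \<otimes>\<^bsub>H'\<^esub> q x) = h a x" if "a \<in> D'" "x \<in> K" for a x
      proof -
        have x: "x \<in> carrier G" "p x = \<one>\<^bsub>H\<^esub>" using that by (auto simp: K_def)
        have a: "a \<in> carrier H" using that D' D(2) M by blast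
        have pa: "p (s a \<otimes> x) = a" using s[OF that(1)] x a by simp
        have "g (q (s a) \<otimes>\<^bsub>H'\<^esub> q x) = f (s a \<otimes> x)" using s[OF that(1)] x fg by simp
        also have "\<dots> = h a (inv (s a) \<otimes> (s a \<otimes> x))" using f(2)[of "s a \<otimes> x"] pa s[OF that(1)] x that(1) by simp
        also have "\<dots> = h a x" using s[OF that(1)] x by simp
        finally show ?thesis .
      qed
      \<comment> \<open>The functions on \<open>Z\<close> are as far apart as the \<open>h a\<close>
        are on \<open>K\<close>, because \<open>Z\<close> is the image of \<open>K\<close> and
        \<open>key\<close> identifies their values.\<close>
      have "countable D'"
      proof (rule countable_separated_functions[of Z D' "\<lambda>a z. g (q (s a) \<otimes>\<^bsub>H'\<^esub> z)"])
        show Zc: "compact_space Z"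
          unfolding Z_def using image_compactin[OF K qcont] by (simp add: compact_space_subtopology)
        show "second_countable Z"
          using compact_imp_Lindelof_space[OF Zc] metrizable_space_subtopology[OF H'(2)]
          unfolding Z_def by (rule metrizable_Lindelof_imp_second_countable[rotated])
        show "continuous_map Z euclideanreal (\<lambda>z. g (q (s a) \<otimes>\<^bsub>H'\<^esub> z))" if a: "a \<in> D'" for a
        proof -
          have "continuous_map S' S' (\<lambda>z. q (s a) \<otimes>\<^bsub>H'\<^esub> z)"
            using s(1)[OF a] by (intro H'.continuous_map_mult H'.continuous_map_const_group) auto
          then have "continuous_map S' euclideanreal (\<lambda>z. g (q (s a) \<otimes>\<^bsub>H'\<^esub> z))"
            by (rule continuous_map_compose[OF _ g, unfolded o_def])
          then show ?thesis unfolding Z_def by (rule continuous_map_from_subtopology)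
        qed
        fix a b assume ab: "a \<in> D'" "b \<in> D'" "a \<noteq> b"
        then have "h a \<in> \<F>" "h b \<in> \<F>" "h a \<noteq> h b" using D'(3,4) by (auto dest: inj_onD)
        then have "R (h a) (h b)" using \<F>(2) by (simp add: pairwise_def)
        then obtain x where "x \<in> K" "1/4 \<le> \<bar>h a x - h b x\<bar>" by (auto simp: R_def)
        then show "\<exists>z\<in>topspace Z. 1/4 \<le> \<bar>g (q (s a) \<otimes>\<^bsub>H'\<^esub> z) - g (q (s b) \<otimes>\<^bsub>H'\<^esub> z)\<bar>"
          using key ab topZ by (intro bexI[of _ "q x"]) auto
      qed
      then show False using D'(2) by simp
    qed
    then show ?thesis using PR_factorizable_if_perfect_hom[OF H(1) _ p] by blast
  qed simp
qed

end

subsection \<open>Products and factors\<close>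

lemma topological_group_product:
  assumes "\<And>i. i \<in> I \<Longrightarrow> topological_group (G i) (T i)"
  shows "topological_group (product_group I G) (product_topology T I)"
proof -
  have tg: "top_group (G i) (T i)" if "i \<in> I" for i
    using assms[OF that] by (rule topological_group_imp_top_group)
  have gr: "group (G i)" if "i \<in> I" for i
    using tg[OF that] by (simp add: top_group_def)
  have top: "topspace (product_topology T I) = (\<Pi>\<^sub>E i\<in>I. carrier (G i))"
    using top_group.topspace_eq[OF tg] by (simp cong: PiE_cong)
  have proj: "continuous_map (product_topology T I) (T i) (\<lambda>x. x i)" if "i \<in> I" for i
    using that by (rule continuous_map_product_projection)
  show ?thesis
    unfolding topological_group_def
  proof (intro conjI)
    show "group (product_group I G)" using gr by simp
    show "topspace (product_topology T I) = carrier (product_group I G)" using top by simp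
    show "Hausdorff_space (product_topology T I)"
      using top_group.Hausdorff[OF tg] by (simp add: Hausdorff_space_product_topology)
    have "continuous_map (prod_topology (product_topology T I) (product_topology T I)) (T i)
        (\<lambda>z. fst z i \<otimes>\<^bsub>G i\<^esub> snd z i)" if i: "i \<in> I" for i
      using continuous_map_compose[OF continuous_map_fst proj[OF i]]
        continuous_map_compose[OF continuous_map_snd proj[OF i]]
      by (intro top_group.continuous_map_mult[OF tg[OF i]]) (simp_all add: o_def)
    then show "continuous_map (prod_topology (product_topology T I) (product_topology T I))
        (product_topology T I) (\<lambda>(x, y). x \<otimes>\<^bsub>product_group I G\<^esub> y)"
      by (simp add: continuous_map_componentwise case_prod_unfold image_subset_iff)
    have "continuous_map (product_topology T I) (product_topology T I) (\<lambda>x. \<lambda>i\<in>I. inv\<^bsub>G i\<^esub> (x i))"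
      using top_group.continuous_map_inv[OF tg proj]
      by (simp add: continuous_map_componentwise image_subset_iff)
    then show "continuous_map (product_topology T I) (product_topology T I) (\<lambda>x. inv\<^bsub>product_group I G\<^esub> x)"
      by (rule continuous_map_eq) (use gr top in simp)
  qed
qed

text \<open>Boxes are coded by finite sets of pairs of an index and a basic open set, so their
  countability is that of the finite subsets of a countable set.\<close>

lemma second_countable_product_topology:
  fixes X :: "nat \<Rightarrow> 'a topology"
  assumes "\<And>n. second_countable (X n)"
  shows "second_countable (product_topology X UNIV)"
proof -
  have "\<forall>n. \<exists>\<B>. countable \<B> \<and> (\<forall>V\<in>\<B>. openin (X n) V) \<and>
      (\<forall>U x. openin (X n) U \<and> x \<in> U \<longrightarrow> (\<exists>V\<in>\<B>. x \<in> V \<and> V \<subseteq> U))"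
    using assms unfolding second_countable_def by blast
  then obtain \<B> where \<B>: "\<And>n. countable (\<B> n)" "\<And>n V. V \<in> \<B> n \<Longrightarrow> openin (X n) V"
    "\<And>n U x. openin (X n) U \<Longrightarrow> x \<in> U \<Longrightarrow> \<exists>V\<in>\<B> n. x \<in> V \<and> V \<subseteq> U"
    by metis
  define box where "box F = {x \<in> topspace (product_topology X UNIV). \<forall>z\<in>F. x (fst z) \<in> snd z}" for F :: "(nat \<times> 'a set) set"
  define \<F> where "\<F> = {F. finite F \<and> F \<subseteq> (SIGMA n:UNIV. \<B> n)}"
  show ?thesis
    unfolding second_countable_def
  proof (intro exI[of _ "box ` \<F>"] conjI ballI allI impI)
    have "countable \<F>"
      unfolding \<F>_def using \<B>(1) by (intro countable_Collect_finite_subset countable_SIGMA) auto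
    then show "countable (box ` \<F>)" by simp
    have "openin (product_topology X UNIV) (box F)" if "F \<in> \<F>" for F
    proof -
      have F: "finite F" "F \<subseteq> (SIGMA n:UNIV. \<B> n)" using that by (auto simp: \<F>_def)
      have "openin (product_topology X UNIV) {x \<in> topspace (product_topology X UNIV). x n \<in> V}" if "(n, V) \<in> F" for n V
        using F(2) that \<B>(2)
        by (intro openin_continuous_map_preimage[OF continuous_map_product_projection]) auto
      then have "openin (product_topology X UNIV)
          (topspace (product_topology X UNIV) \<inter> (\<Inter>z\<in>F. {x \<in> topspace (product_topology X UNIV). x (fst z) \<in> snd z}))"
        using F(1) by (intro openin_Int_Inter) (auto simp del: topspace_product_topology)
      moreover have "topspace (product_topology X UNIV) \<inter> (\<Inter>z\<in>F. {x \<in> topspace (product_topology X UNIV). x (fst z) \<in> snd z}) = box F"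
        by (auto simp: box_def)
      ultimately show ?thesis by simp
    qed
    then show "openin (product_topology X UNIV) V" if "V \<in> box ` \<F>" for V using that by blast
    fix U x assume Ux: "openin (product_topology X UNIV) U \<and> x \<in> U"
    then obtain W where W: "finite {n. W n \<noteq> topspace (X n)}" "\<And>n. openin (X n) (W n)"
      "x \<in> Pi\<^sub>E UNIV W" "Pi\<^sub>E UNIV W \<subseteq> U"
      unfolding openin_product_topology_alt by fastforce
    have "\<exists>V\<in>\<B> n. x n \<in> V \<and> V \<subseteq> W n" for n
      using W(2,3) by (intro \<B>(3)) auto
    then obtain V where V: "\<And>n. V n \<in> \<B> n" "\<And>n. x n \<in> V n" "\<And>n. V n \<subseteq> W n" by metis
    define F where "F = (\<lambda>n. (n, V n)) ` {n. W n \<noteq> topspace (X n)}"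
    have "F \<in> \<F>" using W(1) V(1) by (auto simp: F_def \<F>_def)
    moreover have "x \<in> box F"
      using Ux V(2) openin_subset by (fastforce simp: box_def F_def)
    moreover have "box F \<subseteq> Pi\<^sub>E UNIV W"
    proof
      fix y assume y: "y \<in> box F"
      have "y n \<in> W n" for n
        using y V(3)[of n] by (cases "W n = topspace (X n)") (auto simp: box_def F_def PiE_iff)
      then show "y \<in> Pi\<^sub>E UNIV W" by auto
    qed
    ultimately show "\<exists>V\<in>box ` \<F>. x \<in> V \<and> V \<subseteq> U" using W(4) by blast
  qed
qed

text \<open>In a metrizable target, a k-space whose compact sets are closed, properness reduces to
  compactness of preimages. A compact set lies in the product of its projections; the preimage of
  that product is compact by Tychonoff's theorem, and the preimage of the set is closed in
  it.\<close>

lemma perfect_map_product: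
  assumes p: "\<And>i. i \<in> I \<Longrightarrow> perfect_map (X i) (Y i) (p i)" and Y: "metrizable_space (product_topology Y I)"
  shows "perfect_map (product_topology X I) (product_topology Y I) (\<lambda>x. \<lambda>i\<in>I. p i (x i))"
  unfolding perfect_map_def
proof (intro conjI)
  have cont: "continuous_map (X i) (Y i) (p i)" and proper: "proper_map (X i) (Y i) (p i)"
    and surj: "p i ` topspace (X i) = topspace (Y i)" if "i \<in> I" for i
    using p[OF that] by (auto simp: perfect_map_def)
  let ?p = "\<lambda>x. \<lambda>i\<in>I. p i (x i)"
  have "continuous_map (product_topology X I) (Y i) (\<lambda>x. p i (x i))" if i: "i \<in> I" for i
    using continuous_map_compose[OF continuous_map_product_projection[OF i, of X] cont[OF i]] by (simp add: o_def)
  then show c: "continuous_map (product_topology X I) (product_topology Y I) ?p"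
    by (simp add: continuous_map_componentwise image_subset_iff)
  then have fim: "?p \<in> topspace (product_topology X I) \<rightarrow> topspace (product_topology Y I)"
    using continuous_map_funspace by blast
  show "?p ` topspace (product_topology X I) = topspace (product_topology Y I)"
  proof
    show "?p ` topspace (product_topology X I) \<subseteq> topspace (product_topology Y I)" using fim by blast
    show "topspace (product_topology Y I) \<subseteq> ?p ` topspace (product_topology X I)"
    proof
      fix y assume y: "y \<in> topspace (product_topology Y I)"
      have "\<exists>x\<in>topspace (X i). p i x = y i" if "i \<in> I" for i
        using surj[OF that] y that by (force simp: PiE_iff)
      then obtain x where x: "\<And>i. i \<in> I \<Longrightarrow> x i \<in> topspace (X i) \<and> p i (x i) = y i" by metis
      have "?p (restrict x I) = y" using x y by (auto simp: PiE_iff extensional_def fun_eq_iff)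
      then show "y \<in> ?p ` topspace (product_topology X I)"
        using x by (intro image_eqI[of _ _ "restrict x I"]) auto
    qed
  qed
  show "proper_map (product_topology X I) (product_topology Y I) ?p"
  proof (rule compact_imp_proper_map)
    show "k_space (product_topology Y I)" using Y by (rule metrizable_imp_k_space)
    show kc: "kc_space (product_topology Y I)" using Y by (intro Hausdorff_imp_kc_space metrizable_imp_Hausdorff_space)
    fix K assume K: "compactin (product_topology Y I) K"
    define C where "C = (\<Pi>\<^sub>E i\<in>I. {x \<in> topspace (X i). p i x \<in> (\<lambda>y. y i) ` K})"
    have "compactin (X i) {x \<in> topspace (X i). p i x \<in> (\<lambda>y. y i) ` K}" if "i \<in> I" for i
      using compactin_proper_map_preimage[OF proper[OF that]]
        image_compactin[OF K continuous_map_product_projection[OF that]] by simp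
    then have "compactin (product_topology X I) C"
      unfolding C_def by (simp add: compactin_PiE)
    moreover have "closedin (product_topology X I) {x \<in> topspace (product_topology X I). ?p x \<in> K}"
      using K kc by (intro closedin_continuous_map_preimage[OF c]) (auto simp: kc_space_def)
    moreover have "{x \<in> topspace (product_topology X I). ?p x \<in> K} \<subseteq> C"
    proof
      fix x assume x: "x \<in> {x \<in> topspace (product_topology X I). ?p x \<in> K}"
      have "p i (x i) \<in> (\<lambda>y. y i) ` K" if "i \<in> I" for i
        using x that by (intro image_eqI[of _ _ "?p x"]) auto
      then show "x \<in> C" using x by (auto simp: C_def PiE_iff)
    qed
    ultimately show "compactin (product_topology X I) {x \<in> topspace (product_topology X I). ?p x \<in> K}"
      by (meson closed_compactin)
  qed (use fim c in auto)
qed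

section \<open>Elementary implications and proper homomorphisms\<close>

context top_group
begin

lemma PM_factorizable_if_metrizable:
  assumes "metrizable_space T"
  shows "PM_factorizable G T"
  unfolding PM_factorizable_def
proof (intro allI impI)
  fix f :: "'a \<Rightarrow> real" assume "continuous_map T euclideanreal f"
  moreover have "perfect_hom G T G T id" by (simp add: perfect_hom_def hom_def)
  ultimately show "\<exists>(H :: 'a monoid) S p g. topological_group H S \<and> metrizable_space S \<and>
      perfect_hom G T H S p \<and> continuous_map S euclideanreal g \<and> (\<forall>x\<in>carrier G. f x = g (p x))"
    using top_group assms by (intro exI[of _ G] exI[of _ T] exI[of _ id] exI[of _ f]) auto
qed

lemma PR_imp_PM_factorizable:
  assumes "PR_factorizable G T"
  shows "PM_factorizable G T"
  using assms top_group.second_countable_imp_metrizable[OF topological_group_imp_top_group]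
  unfolding PR_factorizable_def PM_factorizable_def by meson

text \<open>Converse of \<open>PR_factorizable_if_perfect_hom\<close>, obtained from a constant
  function. Together they replace the quantifier over functions by the existence of one
  homomorphism.\<close>

lemma PR_factorizable_perfect_hom:
  assumes "PR_factorizable G T"
  obtains H :: "'a monoid" and S p where
    "topological_group H S" "second_countable S" "perfect_hom G T H S p"
proof -
  have "continuous_map T euclideanreal (\<lambda>_. 0 :: real)" by simp
  then show ?thesis using assms that unfolding PR_factorizable_def by meson
qed

lemma topological_subgroup:
  assumes K: "subgroup K G"
  shows "topological_group (G\<lparr>carrier := K\<rparr>) (subtopology T K)"
proof -
  have sub: "K \<subseteq> carrier G" using K by (rule subgroup.subset)
  show ?thesis
    unfolding topological_group_def
  proof (intro conjI)
    show "group (G\<lparr>carrier := K\<rparr>)" using K is_group by (rule subgroup.subgroup_is_group)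
    show "topspace (subtopology T K) = carrier (G\<lparr>carrier := K\<rparr>)" using sub by auto
    show "Hausdorff_space (subtopology T K)" using Hausdorff by (rule Hausdorff_space_subtopology)
    have "continuous_map (subtopology (prod_topology T T) (K \<times> K)) (subtopology T K) (\<lambda>(x, y). x \<otimes> y)"
      using continuous_map_from_subtopology[OF continuous_mult] subgroup.m_closed[OF K]
      by (auto simp: continuous_map_in_subtopology)
    then show "continuous_map (prod_topology (subtopology T K) (subtopology T K)) (subtopology T K)
        (\<lambda>(x, y). x \<otimes>\<^bsub>G\<lparr>carrier := K\<rparr>\<^esub> y)"
      by (simp add: subtopology_Times)
    have "continuous_map (subtopology T K) (subtopology T K) (\<lambda>x. inv x)"
      using continuous_map_from_subtopology[OF continuous_inv] subgroup.m_inv_closed[OF K]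
      by (auto simp: continuous_map_in_subtopology)
    then show "continuous_map (subtopology T K) (subtopology T K) (\<lambda>x. inv\<^bsub>G\<lparr>carrier := K\<rparr>\<^esub> x)"
      by (rule continuous_map_eq) (use m_inv_consistent[OF K] in simp)
  qed
qed

text \<open>Shrinking the codomain to the image, a second countable subgroup, restores surjectivity.
  This covers restrictions of perfect homomorphisms, which are rarely onto.\<close>

lemma PR_factorizable_if_proper_hom:
  fixes H :: "'b monoid"
  assumes H: "topological_group H S" "second_countable S"
    and p: "p \<in> hom G H" "continuous_map T S p" "proper_map T S p"
  shows "PR_factorizable G T"
proof -
  interpret H: top_group H S using H(1) by (rule topological_group_imp_top_group)
  interpret p: group_hom G H p
    using p(1) by (simp add: group_hom_def group_hom_axioms_def)
  define K where "K = p ` carrier G"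
  have K: "subgroup K H" unfolding K_def by (rule p.img_is_subgroup)
  have "perfect_map T (subtopology S K) p"
    unfolding perfect_map_def
    using p proper_map_into_subtopology[OF p(3), of K] subgroup.subset[OF K]
    by (auto simp: K_def continuous_map_in_subtopology)
  moreover have "p \<in> hom G (H\<lparr>carrier := K\<rparr>)"
    using p(1) by (auto simp: hom_def K_def)
  ultimately have "perfect_hom G T (H\<lparr>carrier := K\<rparr>) (subtopology S K) p"
    by (simp add: perfect_hom_def)
  then show ?thesis
    using PR_factorizable_if_perfect_hom H.topological_subgroup[OF K] second_countable_subtopology[OF H(2)]
    by blast
qed

end

text \<open>The factor sits in the product as a closed subgroup via \<open>j\<close>, and a perfect
  homomorphism of the product stays proper on it.\<close>

lemma PR_factorizable_factor:
  fixes G :: "'i \<Rightarrow> 'a monoid" and T :: "'i \<Rightarrow> 'a topology"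
  assumes G: "\<And>i. i \<in> I \<Longrightarrow> topological_group (G i) (T i)"
    and PR: "PR_factorizable (product_group I G) (product_topology T I)" and k: "k \<in> I"
  shows "PR_factorizable (G k) (T k)"
proof -
  have tg: "top_group (G i) (T i)" if "i \<in> I" for i
    using G[OF that] by (rule topological_group_imp_top_group)
  then have gr: "group (G i)" if "i \<in> I" for i
    using that by (simp add: top_group_def)
  interpret k: top_group "G k" "T k" using k by (rule tg)
  interpret P: top_group "product_group I G" "product_topology T I"
    by (rule topological_group_imp_top_group[OF topological_group_product[OF G]])
  obtain H :: "('i \<Rightarrow> 'a) monoid" and S q where H: "topological_group H S" "second_countable S"
    and q: "perfect_hom (product_group I G) (product_topology T I) H S q"
    using P.PR_factorizable_perfect_hom[OF PR] by blast
  define j where "j x = (\<lambda>i\<in>I. if i = k then x else \<one>\<^bsub>G i\<^esub>)" for x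
  have jhom: "j \<in> hom (G k) (product_group I G)"
    using gr by (auto simp: hom_def j_def group.is_monoid fun_eq_iff)
  have jcont: "continuous_map (T k) (product_topology T I) j"
    unfolding continuous_map_componentwise
  proof (intro conjI ballI)
    show "j ` topspace (T k) \<subseteq> extensional I" by (auto simp: j_def)
    show "continuous_map (T k) (T i) (\<lambda>x. j x i)" if i: "i \<in> I" for i
      using i top_group.topspace_eq[OF tg[OF i]] group.is_monoid[OF gr[OF i]]
      by (cases "i = k") (simp_all add: j_def)
  qed
  \<comment> \<open>The projection to coordinate \<open>k\<close> is a continuous left inverse of
    \<open>j\<close>; as the identity is proper and the product is Hausdorff, so is \<open>j\<close>
    proper.\<close>
  have "proper_map (T k) (T k) ((\<lambda>x. x k) \<circ> j)"
    by (rule proper_map_eq[OF proper_map_id]) (simp add: j_def k)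
  then have jprop: "proper_map (T k) (product_topology T I) j"
    using proper_map_from_composition_right[OF P.Hausdorff _ jcont continuous_map_product_projection[OF k]]
    by blast
  have q': "q \<in> hom (product_group I G) H" "continuous_map (product_topology T I) S q"
    "proper_map (product_topology T I) S q"
    using q by (auto simp: perfect_hom_def perfect_map_def)
  show ?thesis
  proof (rule k.PR_factorizable_if_proper_hom[OF H])
    show "q \<circ> j \<in> hom (G k) H" using jhom q'(1) by (rule hom_compose)
    show "continuous_map (T k) S (q \<circ> j)" using jcont q'(2) by (rule continuous_map_compose)
    show "proper_map (T k) S (q \<circ> j)" using jprop q'(3) by (rule proper_map_compose)
  qed
qed

text \<open>Homomorphisms chosen factor by factor combine into one. Countability of the index set
  keeps the target second countable, hence metrizable, as \<open>perfect_map_product\<close>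
  requires.\<close>

lemma PR_factorizable_product:
  fixes G :: "nat \<Rightarrow> 'a monoid" and T :: "nat \<Rightarrow> 'a topology"
  assumes G: "\<And>n. topological_group (G n) (T n)" and PR: "\<And>n. PR_factorizable (G n) (T n)"
  shows "PR_factorizable (product_group UNIV G) (product_topology T UNIV)"
proof -
  interpret P: top_group "product_group UNIV G" "product_topology T UNIV"
    by (rule topological_group_imp_top_group[OF topological_group_product[OF G]])
  have "\<exists>(H :: 'a monoid) S p. topological_group H S \<and> second_countable S \<and> perfect_hom (G n) (T n) H S p" for n
    using top_group.PR_factorizable_perfect_hom[OF topological_group_imp_top_group[OF G] PR] by metis
  then obtain H :: "nat \<Rightarrow> 'a monoid" and S p where
    H: "\<And>n. topological_group (H n) (S n)" "\<And>n. second_countable (S n)"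
    and p: "\<And>n. perfect_hom (G n) (T n) (H n) (S n) (p n)" by metis
  have top: "topological_group (product_group UNIV H) (product_topology S UNIV)"
    using H(1) by (rule topological_group_product)
  have sc: "second_countable (product_topology S UNIV)"
    using H(2) by (rule second_countable_product_topology)
  have "metrizable_space (product_topology S UNIV)"
    using top_group.second_countable_imp_metrizable[OF topological_group_imp_top_group[OF top] sc] .
  then have "perfect_map (product_topology T UNIV) (product_topology S UNIV) (\<lambda>x. \<lambda>n\<in>UNIV. p n (x n))"
    using p by (intro perfect_map_product) (auto simp: perfect_hom_def)
  moreover have "(\<lambda>x. \<lambda>n\<in>UNIV. p n (x n)) \<in> hom (product_group UNIV G) (product_group UNIV H)"
    using p by (auto simp: perfect_hom_def hom_def PiE_iff Pi_iff)
  ultimately have "perfect_hom (product_group UNIV G) (product_topology T UNIV)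
      (product_group UNIV H) (product_topology S UNIV) (\<lambda>x. \<lambda>n\<in>UNIV. p n (x n))"
    by (simp add: perfect_hom_def)
  then show ?thesis by (rule P.PR_factorizable_if_perfect_hom[OF top sc])
qed

theorem theorem4p2:
  fixes G :: "nat \<Rightarrow> 'a monoid" and T :: "nat \<Rightarrow> 'a topology"
  assumes "\<And>n. topological_group (G n) (T n)"
    and "\<And>n. PM_factorizable (G n) (T n)"
  shows "PM_factorizable (product_group UNIV G) (product_topology T UNIV) \<longleftrightarrow>
           (\<forall>n. metrizable_space (T n)) \<or> (\<forall>n. PR_factorizable (G n) (T n))"
proof -
  interpret P: top_group "product_group UNIV G" "product_topology T UNIV"
    by (rule topological_group_imp_top_group[OF topological_group_product[OF assms(1)]])
  \<comment> \<open>The product contains its unit. This excludes the empty product, which would be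
    metrizable whatever its factors; over a countable index set the criterion then becomes
    metrizability of every factor.\<close>
  have "product_topology T UNIV \<noteq> trivial_topology"
    using P.one_closed P.topspace_eq by (metis empty_iff topspace_discrete_topology)
  then have metrizable: "metrizable_space (product_topology T UNIV) \<longleftrightarrow> (\<forall>n. metrizable_space (T n))"
    by (simp add: metrizable_space_product_topology)
  show ?thesis
  proof
    assume "PM_factorizable (product_group UNIV G) (product_topology T UNIV)"
    then have "metrizable_space (product_topology T UNIV) \<or>
        PR_factorizable (product_group UNIV G) (product_topology T UNIV)"
      by (rule P.PM_factorizable_imp_metrizable_or_PR)
    then show "(\<forall>n. metrizable_space (T n)) \<or> (\<forall>n. PR_factorizable (G n) (T n))"
      using metrizable PR_factorizable_factor[of UNIV G T] assms(1) by blast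
  next
    assume "(\<forall>n. metrizable_space (T n)) \<or> (\<forall>n. PR_factorizable (G n) (T n))"
    then show "PM_factorizable (product_group UNIV G) (product_topology T UNIV)"
    proof
      assume "\<forall>n. metrizable_space (T n)"
      then show ?thesis using metrizable by (intro P.PM_factorizable_if_metrizable) simp
    next
      assume "\<forall>n. PR_factorizable (G n) (T n)"
      then show ?thesis using assms(1) by (intro P.PR_imp_PM_factorizable PR_factorizable_product) auto
    qed
  qed
qed

end
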